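(* Let $\nu$ be a Borel probability measure on $\operatorname{Diff}^{1+\tau}(\mathbb{S}^1)$ (some $\tau>0$) satisfying $$\int\log\sup_{x\in\mathbb{S}^1}|f'(x)|\,d\nu(f)<\infty\quad\text{and}\quad\int\log\inf_{x\in\mathbb{S}^1}|f'(x)|\,d\nu(f)>-\infty.$$ Assume that $\Gamma_\nu$ is proximal and does not fix any point in $\mathbb{S}^1$. Let $\pi,\theta\colon X_\nu^{\mathbb{N}}\to\mathbb{S}^1$ be measurable maps such that for all $x\in\mathbb{S}^1$ and $\nu^{\mathbb{N}}$-almost every $\omega=(f_n)_{n\in\mathbb{N}}$, $\lim_{n}f_1\circ\cdots\circ f_n(x)=\pi(\omega)$ and $\lim_{n}f_1^{-1}\circ\cdots\circ f_n^{-1}(x)=\theta(\omega)$. Then for $\nu^{\mathbb{N}}$-almost every $\omega=(f_n)_{n\in\mathbb{N}}\in X_\nu^{\mathbb{N}}$ and every $x\in\mathbb{S}^1$, $$\lim_{n\to\infty}\frac1n\log|(f_n^{-1}\circ\cdots\circ f_1^{-1})'(x)|=\begin{cases}-\Lambda(\nu),&x\ne\pi(\omega),\\-\lambda(\nu),&x=\pi(\omega),\end{cases}$$ and $$\lim_{n\to\infty}\frac1n\log|(f_n\circ\cdots\circ f_1)'(x)|=\begin{cases}\lambda(\nu),&x\ne\theta(\omega),\\\Lambda(\nu),&x=\theta(\omega).\end{cases}$$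
   Context: $\mathbb{S}^1=\mathbb{R}/\mathbb{Z}$ with usual metric $d$. $\operatorname{Diff}^{1+\tau}(\mathbb{S}^1)$ is the group of $C^1$ diffeomorphisms of $\mathbb{S}^1$ (orientation preserving or reversing) whose derivative is $\tau$-Hölder. $X_\nu$ is the topological support of $\nu$, $\Gamma_\nu$ the semigroup generated by $X_\nu$. $\Gamma_\nu$ is proximal if for all $x,y\in\mathbb{S}^1$ there is a sequence $(g_n)$ in $\Gamma_\nu$ with $d(g_n(x),g_n(y))\to0$; it does not fix any point if no $x$ satisfies $f(x)=x$ for all $f\in\Gamma_\nu$. $\nu^{\mathbb{N}}$ is the product measure on $X_\nu^{\mathbb{N}}$. For $\omega=(f_n)_{n\in\mathbb{N}}$ write $f^n_\omega=f_n\circ\cdots\circ f_1$. The extremal Lyapunov exponents are the $\nu^{\mathbb{N}}$-almost sure limits (which exist and are constant by Kingman's subadditive ergodic theorem) $\Lambda(\nu)=\lim_n\frac1n\log\sup_{z}|(f^n_\omega)'(z)|$ and $\lambda(\nu)=\lim_n\frac1n\log\inf_z|(f^n_\omega)'(z)|$. *)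

theory Defs
  imports "HOL-Analysis.Analysis" "HOL-Probability.Probability"
begin

text \<open>The circle S^1 = R/Z. A point of S^1 is represented by any real number
  (its lift); two reals represent the same point iff they differ by an integer.\<close>

definition circ_eq :: "real \<Rightarrow> real \<Rightarrow> bool" where
  "circ_eq x y \<longleftrightarrow> x - y \<in> \<int>"

definition dS1 :: "real \<Rightarrow> real \<Rightarrow> real" where
  "dS1 x y = min (frac (x - y)) (1 - frac (x - y))"

text \<open>Diff^{1+tau}(S^1): a C^1 diffeomorphism of the circle (orientation preserving
  or reversing) is represented by its unique lift F : R -> R which is a C^1
  diffeomorphism of R with F(x+1) = F(x) + 1 or F(x+1) = F(x) - 1 for all x,
  normalised by 0 <= F 0 < 1. The derivative is tau-Hoelder w.r.t. the circle metric.\<close>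

definition Diff1tau :: "real \<Rightarrow> (real \<Rightarrow> real) set" where
  "Diff1tau \<tau> = {F. bij F \<and> (\<forall>x. F differentiable (at x)) \<and> continuous_on UNIV (deriv F)
      \<and> (\<forall>x. deriv F x \<noteq> 0)
      \<and> ((\<forall>x. F (x + 1) = F x + 1) \<or> (\<forall>x. F (x + 1) = F x - 1))
      \<and> 0 \<le> F 0 \<and> F 0 < 1
      \<and> (\<exists>C. \<forall>x y. \<bar>deriv F x - deriv F y\<bar> \<le> C * dS1 x y powr \<tau>)}"

definition dC1 :: "(real \<Rightarrow> real) \<Rightarrow> (real \<Rightarrow> real) \<Rightarrow> real" where
  "dC1 F G = (SUP x. dS1 (F x) (G x)) + (SUP x. \<bar>deriv F x - deriv G x\<bar>)"

definition C1top :: "real \<Rightarrow> (real \<Rightarrow> real) topology" where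
  "C1top \<tau> = topology (\<lambda>U. U \<subseteq> Diff1tau \<tau> \<and>
      (\<forall>F\<in>U. \<exists>e>0. \<forall>G\<in>Diff1tau \<tau>. dC1 F G < e \<longrightarrow> G \<in> U))"

definition borel_prob_Diff :: "real \<Rightarrow> (real \<Rightarrow> real) measure \<Rightarrow> bool" where
  "borel_prob_Diff \<tau> \<nu> \<longleftrightarrow> prob_space \<nu> \<and> space \<nu> = Diff1tau \<tau>
      \<and> sets \<nu> = sigma_sets (Diff1tau \<tau>) {U. openin (C1top \<tau>) U}"

definition supp :: "real \<Rightarrow> (real \<Rightarrow> real) measure \<Rightarrow> (real \<Rightarrow> real) set" where
  "supp \<tau> \<nu> = {F \<in> Diff1tau \<tau>. \<forall>U. openin (C1top \<tau>) U \<and> F \<in> U \<longrightarrow> emeasure \<nu> U > 0}"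

inductive_set semigrp :: "(real \<Rightarrow> real) set \<Rightarrow> (real \<Rightarrow> real) set" for X where
  gen: "F \<in> X \<Longrightarrow> F \<in> semigrp X"
| comp: "F \<in> semigrp X \<Longrightarrow> G \<in> semigrp X \<Longrightarrow> G \<circ> F \<in> semigrp X"

definition proximal :: "(real \<Rightarrow> real) set \<Rightarrow> bool" where
  "proximal \<Gamma> \<longleftrightarrow> (\<forall>x y. \<exists>g. (\<forall>n. g n \<in> \<Gamma>) \<and> (\<lambda>n. dS1 (g n x) (g n y)) \<longlonglongrightarrow> 0)"

definition fixes_point :: "(real \<Rightarrow> real) set \<Rightarrow> bool" where
  "fixes_point \<Gamma> \<longleftrightarrow> (\<exists>x. \<forall>f\<in>\<Gamma>. circ_eq (f x) x)"

text \<open>For omega = (f_1, f_2, ...) we write f_{i+1} = omega i.\<close>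

primrec fwd :: "(nat \<Rightarrow> real \<Rightarrow> real) \<Rightarrow> nat \<Rightarrow> real \<Rightarrow> real" where
  "fwd \<omega> 0 = id"
| "fwd \<omega> (Suc n) = \<omega> n \<circ> fwd \<omega> n"

primrec bwd :: "(nat \<Rightarrow> real \<Rightarrow> real) \<Rightarrow> nat \<Rightarrow> real \<Rightarrow> real" where
  "bwd \<omega> 0 = id"
| "bwd \<omega> (Suc n) = bwd \<omega> n \<circ> \<omega> n"

primrec invfwd :: "(nat \<Rightarrow> real \<Rightarrow> real) \<Rightarrow> nat \<Rightarrow> real \<Rightarrow> real" where
  "invfwd \<omega> 0 = id"
| "invfwd \<omega> (Suc n) = inv (\<omega> n) \<circ> invfwd \<omega> n"

primrec invbwd :: "(nat \<Rightarrow> real \<Rightarrow> real) \<Rightarrow> nat \<Rightarrow> real \<Rightarrow> real" where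
  "invbwd \<omega> 0 = id"
| "invbwd \<omega> (Suc n) = invbwd \<omega> n \<circ> inv (\<omega> n)"

definition prodM :: "(real \<Rightarrow> real) measure \<Rightarrow> (nat \<Rightarrow> real \<Rightarrow> real) measure" where
  "prodM \<nu> = PiM UNIV (\<lambda>_. \<nu>)"

definition supder :: "(real \<Rightarrow> real) \<Rightarrow> real" where
  "supder F = (SUP z. \<bar>deriv F z\<bar>)"

definition infder :: "(real \<Rightarrow> real) \<Rightarrow> real" where
  "infder F = (INF z. \<bar>deriv F z\<bar>)"

text \<open>Extremal Lyapunov exponents, defined as the (almost surely constant) a.s. limits.\<close>
definition LyapMax :: "(real \<Rightarrow> real) measure \<Rightarrow> real" where
  "LyapMax \<nu> = (THE L. AE \<omega> in prodM \<nu>.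
      (\<lambda>n. ln (supder (fwd \<omega> n)) / real n) \<longlonglongrightarrow> L)"

definition LyapMin :: "(real \<Rightarrow> real) measure \<Rightarrow> real" where
  "LyapMin \<nu> = (THE L. AE \<omega> in prodM \<nu>.
      (\<lambda>n. ln (infder (fwd \<omega> n)) / real n) \<longlonglongrightarrow> L)"

end

theory Submission
  imports Defs
begin

text \<open>
  Extend the random sequence of maps to the past. The point \<open>\<pi>\<close> computed from the past is a
  stationary starting point \<open>z\<close> independent of the future, and the point \<open>\<theta>\<close> computed from the
  future is equivariant. By ergodicity of the two-sided Bernoulli shift the Birkhoff averages of
  \<open>log |f'|\<close> along the orbits of \<open>z\<close> and of \<open>\<theta>\<close> converge to constants \<open>l\<close> and \<open>L\<close>; moreover
  \<open>z \<noteq> \<theta>\<close> almost surely, since otherwise both points would be constant and the constant would be a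
  common fixed point. As backward images of every point converge to \<open>\<theta>\<close>, the forward maps contract
  the complement of each neighbourhood of \<open>\<theta>\<close>, and since \<open>log |f'|\<close> is uniformly continuous
  every orbit not starting at \<open>\<theta>\<close> has the same exponent \<open>l\<close> as \<open>z\<close>; the mean value theorem gives
  \<open>l \<le> 0\<close>. Running time backwards exchanges \<open>\<pi>\<close> with \<open>\<theta>\<close> and \<open>l\<close> with \<open>-L\<close>, so \<open>L \<ge> 0\<close>.
  Finally an arbitrary orbit shadows first that of \<open>\<theta>\<close> and then that of \<open>z\<close>, uniformly in the
  starting point, so the supremum and the infimum of the derivative grow with rates \<open>L\<close> and \<open>l\<close>.
  In particular the extremal exponents exist without appeal to the subadditive ergodic theorem.
\<close>

text \<open>The difficulty is uniformity. The support of the law of the maps need not be compact, so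
  the modulus of continuity of \<open>log |f'|\<close> depends on \<open>f\<close>; it is averaged
  over \<open>f\<close>, and all errors are measured against an integrable bound \<open>h\<close> of
  \<open>|log |f'||\<close>. Contraction is obtained topologically: if the preimages of an equally
  spaced grid all lie near \<open>\<theta>\<close>, the image of the complementary arc meets no grid
  point and is short. The supremum and infimum need estimates uniform in the starting point, while
  the time \<open>k\<close> at which an orbit leaves the repelling orbit depends on that point;
  hence the derivative is only compared with \<open>k L + (n - k) l\<close>, and the signs of
  \<open>l\<close> and \<open>L\<close> place this between \<open>n l\<close> and
  \<open>n L\<close>. The reference orbit of \<open>z\<close> may itself be close to the repelling
  orbit, or contraction may set in late; the \<open>h\<close>-weighted frequency of such times is
  small by the ergodic theorem, because \<open>z\<close> differs from \<open>\<theta>\<close> almost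
  surely. Finally \<open>z\<close> is random but independent of the future, so a typical past can be
  frozen and \<open>z\<close> becomes one fixed point.\<close>

section \<open>The ergodic theorem for the Bernoulli shift\<close>

text \<open>The recursion computes the maximum of the Birkhoff sums of length at most \<open>n\<close>.\<close>

primrec max_birkhoff :: "('a \<Rightarrow> 'a) \<Rightarrow> ('a \<Rightarrow> real) \<Rightarrow> nat \<Rightarrow> 'a \<Rightarrow> real" where
  "max_birkhoff T g 0 x = 0"
| "max_birkhoff T g (Suc n) x = max 0 (g x + max_birkhoff T g n (T x))"

lemma max_birkhoff_nonneg: "max_birkhoff T g n x \<ge> 0"
  by (cases n) auto

lemma max_birkhoff_Suc_mono: "max_birkhoff T g n x \<le> max_birkhoff T g (Suc n) x"
proof (induction n arbitrary: x)
  case (Suc n)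
  have "max_birkhoff T g n (T x) \<le> max_birkhoff T g (Suc n) (T x)" by (rule Suc)
  then show ?case by simp
qed simp

lemma birkhoff_sum_le_max_birkhoff: "(\<Sum>j<n. g ((T ^^ j) x)) \<le> max_birkhoff T g n x"
proof (induction n arbitrary: x)
  case (Suc n)
  have "(\<Sum>j<Suc n. g ((T ^^ j) x)) = g x + (\<Sum>j<n. g ((T ^^ j) (T x)))"
    by (simp add: sum.lessThan_Suc_shift funpow_swap1 del: sum.lessThan_Suc)
  with Suc[of "T x"] show ?case by simp
qed simp

lemma integrable_compose_preserving:
  fixes f :: "'a \<Rightarrow> real"
  assumes "T \<in> measurable M M" "distr M M T = M" "integrable M f"
  shows "integrable M (\<lambda>x. f (T x))" and "(\<integral>x. f (T x) \<partial>M) = (\<integral>x. f x \<partial>M)"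
  using integrable_distr_eq[OF assms(1), of f] integral_distr[OF assms(1), of f] assms by auto

lemma integrable_max_birkhoff:
  assumes "T \<in> measurable M M" "distr M M T = M" "integrable M g"
  shows "integrable M (max_birkhoff T g n)"
proof (induction n)
  case (Suc n)
  have "max_birkhoff T g (Suc n) = (\<lambda>x. max 0 (g x + max_birkhoff T g n (T x)))" by auto
  then show ?case
    using integrable_compose_preserving(1)[OF assms(1,2) Suc] assms(3) by auto
qed (simp add: max_birkhoff.simps[abs_def])

text \<open>Garsia's argument: where the maximum \<open>m\<close> is positive it equals
  \<open>g\<close> plus the shorter maximum at \<open>T x\<close>, so
  \<open>m - m \<circ> T \<le> g\<close> there; elsewhere \<open>m = 0 \<le> m \<circ> T\<close>.
  The integral of \<open>m - m \<circ> T\<close> vanishes by invariance of the measure.\<close>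

lemma maximal_ergodic:
  assumes T: "T \<in> measurable M M" "distr M M T = M" and g: "integrable M g"
  shows "(\<integral>x. indicator {x. max_birkhoff T g (Suc n) x > 0} x * g x \<partial>M) \<ge> 0"
proof -
  let ?m = "max_birkhoff T g (Suc n)"
  have i1: "integrable M ?m" by (rule integrable_max_birkhoff) fact+
  have [measurable]: "?m \<in> borel_measurable M" using i1 by auto
  have [measurable]: "g \<in> borel_measurable M" using g by auto
  have "0 = (\<integral>x. ?m x - ?m (T x) \<partial>M)"
    using integrable_compose_preserving[OF T i1] i1 by (simp del: max_birkhoff.simps)
  also have "\<dots> \<le> (\<integral>x. indicator {x. ?m x > 0} x * g x \<partial>M)"
  proof (rule integral_mono)
    show "integrable M (\<lambda>x. ?m x - ?m (T x))"
      using integrable_compose_preserving[OF T i1] i1 by (simp del: max_birkhoff.simps)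
    show "integrable M (\<lambda>x. indicator {x. ?m x > 0} x * g x)"
      by (rule Bochner_Integration.integrable_bound[OF g]) (auto split: split_indicator simp del: max_birkhoff.simps)
    fix x
    have "?m (T x) \<ge> max_birkhoff T g n (T x)" by (rule max_birkhoff_Suc_mono)
    moreover have "?m (T x) \<ge> 0" "?m x \<ge> 0" by (rule max_birkhoff_nonneg)+
    ultimately show "?m x - ?m (T x) \<le> indicator {x. ?m x > 0} x * g x"
      by (auto split: split_indicator simp del: max_birkhoff.simps simp: max_birkhoff.simps(2)[of T g n x] max_def
            split: if_splits)
  qed
  finally show ?thesis .
qed

text \<open>Invariance of \<open>A\<close> is required at every point, not almost everywhere; the
  event to which the 0-1 law is applied below is invariant in this strict sense.\<close>

definition ergodic_map :: "'a measure \<Rightarrow> ('a \<Rightarrow> 'a) \<Rightarrow> bool" where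
  "ergodic_map M T \<longleftrightarrow> T \<in> measurable M M \<and> distr M M T = M \<and>
     (\<forall>A\<in>sets M. (\<forall>x\<in>space M. T x \<in> A \<longleftrightarrow> x \<in> A) \<longrightarrow> measure M A \<in> {0, 1})"

lemma funpow_measurable:
  assumes "T \<in> measurable M M" shows "T ^^ n \<in> measurable M M"
proof (induction n)
  case (Suc n)
  from measurable_comp[OF Suc assms] show ?case by (simp add: comp_def)
qed (simp add: id_def)

text \<open>Dropping the first summand changes all sums by the same finite amount, so unboundedness
  is an invariant event and has probability 0 or 1. With probability 1 the indicators in the maximal
  inequality would tend to 1, giving a nonnegative integral of \<open>g\<close>.\<close>

lemma (in prob_space) birkhoff_sums_bounded_above:
  assumes erg: "ergodic_map M T" and g: "integrable M g" and neg: "(\<integral>x. g x \<partial>M) < 0"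
  shows "AE x in M. \<exists>K::nat. \<forall>n. (\<Sum>j<n. g ((T ^^ j) x)) \<le> real K"
proof -
  have T: "T \<in> measurable M M" "distr M M T = M" using erg by (auto simp: ergodic_map_def)
  note [measurable] = T(1) funpow_measurable[OF T(1)] borel_measurable_integrable[OF g]
  define E where "E = {x\<in>space M. \<forall>K::nat. \<exists>n. (\<Sum>j<n. g ((T ^^ j) x)) > real K}"
  have E: "E \<in> sets M" unfolding E_def by measurable
  have step: "(\<Sum>j<Suc n. g ((T ^^ j) x)) = g x + (\<Sum>j<n. g ((T ^^ j) (T x)))" for x n
    by (simp add: sum.lessThan_Suc_shift funpow_swap1 del: sum.lessThan_Suc)
  have "T x \<in> E \<longleftrightarrow> x \<in> E" if x: "x \<in> space M" for x
  proof -
    have Tx: "T x \<in> space M" using measurable_space[OF T(1) x] .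
    have 1: "T x \<in> E" if "x \<in> E"
      unfolding E_def
    proof (safe intro!: Tx)
      \<comment> \<open>The threshold is raised by \<open>\<lceil>\<bar>g x\<bar>\<rceil>\<close> to
        absorb the summand lost in passing from \<open>x\<close> to \<open>T x\<close>; the empty
        sum cannot exceed it, so \<open>n\<close> has a predecessor.\<close>
      fix K :: nat
      obtain n where n: "(\<Sum>j<n. g ((T ^^ j) x)) > real (K + nat \<lceil>\<bar>g x\<bar>\<rceil>)"
        using \<open>x \<in> E\<close> unfolding E_def by blast
      then have "n \<noteq> 0" by (cases "n = 0") (auto simp del: of_nat_add)
      then obtain m where "n = Suc m" by (cases n) auto
      with n step[of x m] have "g x + (\<Sum>j<m. g ((T ^^ j) (T x))) > real K + real (nat \<lceil>\<bar>g x\<bar>\<rceil>)" by simp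
      moreover have "real (nat \<lceil>\<bar>g x\<bar>\<rceil>) \<ge> g x" by linarith
      ultimately show "\<exists>n. real K < (\<Sum>j<n. g ((T ^^ j) (T x)))" by (intro exI[of _ m]) linarith
    qed
    have 2: "x \<in> E" if "T x \<in> E"
      unfolding E_def
    proof (safe intro!: x)
      fix K :: nat
      obtain n where n: "(\<Sum>j<n. g ((T ^^ j) (T x))) > real (K + nat \<lceil>\<bar>g x\<bar>\<rceil>)"
        using \<open>T x \<in> E\<close> unfolding E_def by blast
      moreover have "real (nat \<lceil>\<bar>g x\<bar>\<rceil>) \<ge> - g x" by linarith
      ultimately show "\<exists>n. real K < (\<Sum>j<n. g ((T ^^ j) x))"
        by (intro exI[of _ "Suc n"]) (unfold step, simp add: step)
    qed
    from 1 2 show ?thesis by blast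
  qed
  with erg E have "prob E = 0 \<or> prob E = 1" unfolding ergodic_map_def by auto
  moreover have "prob E \<noteq> 1"
  proof
    assume "prob E = 1"
    then have AE_E: "AE x in M. x \<in> E" using prob_eq_1[OF E] by simp
    have lim: "(\<lambda>n. \<integral>x. indicator {x. max_birkhoff T g (Suc n) x > 0} x * g x \<partial>M) \<longlonglongrightarrow> (\<integral>x. g x \<partial>M)"
    proof (rule integral_dominated_convergence[where w="\<lambda>x. \<bar>g x\<bar>"])
      show "integrable M (\<lambda>x. \<bar>g x\<bar>)" using g by simp
      show "AE x in M. (\<lambda>n. indicator {x. max_birkhoff T g (Suc n) x > 0} x * g x) \<longlonglongrightarrow> g x"
        using AE_E
      proof eventually_elim
        case (elim x)
        then obtain n where n: "(\<Sum>j<n. g ((T ^^ j) x)) > 0"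
          unfolding E_def by (auto dest!: spec[of _ "0::nat"])
        have "max_birkhoff T g (Suc k) x > 0" if "k \<ge> n" for k
        proof -
          have "max_birkhoff T g n x \<le> max_birkhoff T g (Suc k) x"
            by (rule lift_Suc_mono_le[of "\<lambda>n. max_birkhoff T g n x", OF max_birkhoff_Suc_mono]) (use that in simp)
          with birkhoff_sum_le_max_birkhoff[of g T x n] n show ?thesis by linarith
        qed
        then show ?case
          by (intro tendsto_eventually eventually_sequentiallyI[of n]) auto
      qed
      fix n
      have [measurable]: "max_birkhoff T g (Suc n) \<in> borel_measurable M"
        using integrable_max_birkhoff[OF T g] by blast
      show "(\<lambda>x. indicator {x. max_birkhoff T g (Suc n) x > 0} x * g x) \<in> borel_measurable M"
        by measurable
      show "AE x in M. norm (indicator {x. max_birkhoff T g (Suc n) x > 0} x * g x) \<le> \<bar>g x\<bar>"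
        by (auto split: split_indicator)
    qed simp
    have "(\<integral>x. g x \<partial>M) \<ge> 0"
      by (rule LIMSEQ_le_const[OF lim]) (use maximal_ergodic[OF T g] in blast)
    with neg show False by simp
  qed
  ultimately have "prob E = 0" by simp
  then have "AE x in M. x \<notin> E" using prob_eq_0[OF E] by simp
  then show ?thesis
    using AE_space
  proof eventually_elim
    case (elim x)
    then show ?case unfolding E_def by (auto simp: not_less)
  qed
qed

text \<open>Subtracting the mean plus \<open>e/2\<close> leaves an integrand of mean
  \<open>- e/2\<close>, whose sums are bounded above; dividing by \<open>n\<close> makes that bound
  smaller than the remaining \<open>e/2\<close>.\<close>

lemma (in prob_space) birkhoff_limsup:
  assumes erg: "ergodic_map M T" and g: "integrable M g" and e: "e > 0"
  shows "AE x in M. \<forall>\<^sub>F n in sequentially. (\<Sum>j<n. g ((T ^^ j) x)) / real n < (\<integral>x. g x \<partial>M) + e"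
proof -
  let ?I = "\<integral>x. g x \<partial>M"
  let ?g = "\<lambda>x. g x - (?I + e/2)"
  have "AE x in M. \<exists>K::nat. \<forall>n. (\<Sum>j<n. ?g ((T ^^ j) x)) \<le> real K"
    using g e by (intro birkhoff_sums_bounded_above[OF erg]) (auto simp: prob_space)
  then show ?thesis
  proof eventually_elim
    case (elim x)
    then obtain K where K: "\<And>n. (\<Sum>j<n. g ((T ^^ j) x)) \<le> real K + real n * (?I + e/2)"
      by (auto simp: sum_subtractf algebra_simps)
    show ?case
    proof (rule eventually_sequentiallyI)
      fix n assume n: "n \<ge> nat \<lceil>2 * real K / e\<rceil> + 1"
      then have "real n > 2 * real K / e" by linarith
      then have "real K < real n * (e/2)" using e by (simp add: field_simps)
      then have "(\<Sum>j<n. g ((T ^^ j) x)) < real n * (?I + e)" using K[of n] by (simp add: algebra_simps)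
      then show "(\<Sum>j<n. g ((T ^^ j) x)) / real n < ?I + e" using n by (simp add: field_simps)
    qed
  qed
qed

theorem (in prob_space) birkhoff_ergodic:
  assumes erg: "ergodic_map M T" and g: "integrable M g"
  shows "AE x in M. (\<lambda>n. (\<Sum>j<n. g ((T ^^ j) x)) / real n) \<longlonglongrightarrow> (\<integral>x. g x \<partial>M)"
proof -
  let ?I = "\<integral>x. g x \<partial>M"
  have "AE x in M. \<forall>m. \<forall>\<^sub>F n in sequentially. (\<Sum>j<n. g ((T ^^ j) x)) / real n < ?I + inverse (real (Suc m))"
    unfolding AE_all_countable using birkhoff_limsup[OF erg g] by (simp add: del: of_nat_Suc)
  moreover have "AE x in M. \<forall>m. \<forall>\<^sub>F n in sequentially. (\<Sum>j<n. - g ((T ^^ j) x)) / real n < (\<integral>x. - g x \<partial>M) + inverse (real (Suc m))"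
    unfolding AE_all_countable using birkhoff_limsup[OF erg, of "\<lambda>x. - g x"] g by (simp add: del: of_nat_Suc)
  ultimately show ?thesis
  proof eventually_elim
    case (elim x)
    show ?case
    proof (rule tendstoI)
      fix r :: real assume "r > 0"
      then obtain m where m: "inverse (real (Suc m)) < r" using reals_Archimedean by blast
      from elim(1)[rule_format, of m] elim(2)[rule_format, of m]
      show "\<forall>\<^sub>F n in sequentially. dist ((\<Sum>j<n. g ((T ^^ j) x)) / real n) ?I < r"
        by eventually_elim (use m in \<open>auto simp: dist_real_def sum_negf\<close>)
    qed
  qed
qed

section \<open>Bi-infinite sequences and mixing of the Bernoulli shift\<close>

lemma (in prob_space) tendsto_prob_UN:
  fixes A :: "nat \<Rightarrow> 'a set" and B :: "nat \<Rightarrow> nat \<Rightarrow> 'a set"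
  assumes A: "range A \<subseteq> events" "disjoint_family A"
    and B: "\<And>k. range (B k) \<subseteq> events" "\<And>k. disjoint_family (B k)"
    and bound: "\<And>k i. prob (B k i) \<le> prob (A i)"
    and lim: "\<And>i. (\<lambda>k. prob (B k i)) \<longlonglongrightarrow> prob (A i) * c"
  shows "(\<lambda>k. prob (\<Union>i. B k i)) \<longlonglongrightarrow> prob (\<Union>i. A i) * c"
proof -
  have sA: "(\<lambda>i. prob (A i)) sums prob (\<Union>i. A i)" using A by (rule finite_measure_UNION)
  have sB: "prob (\<Union>i. B k i) = (\<Sum>i. prob (B k i))" for k
    using B[of k] by (intro sums_unique finite_measure_UNION)
  \<comment> \<open>Tannery's theorem exchanges limit and series; the summable majorant is
    \<open>prob (A i)\<close>.\<close>
  have "(\<lambda>k. \<Sum>i. prob (B k i)) \<longlonglongrightarrow> (\<Sum>i. prob (A i) * c)"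
    by (rule tannerys_theorem[where M="\<lambda>i. prob (A i)", THEN conjunct2, THEN conjunct2])
       (use lim bound sA in \<open>auto simp: sums_iff intro: always_eventually\<close>)
  moreover have "(\<Sum>i. prob (A i) * c) = prob (\<Union>i. A i) * c"
    using sums_mult2[OF sA, of c] by (simp add: sums_iff)
  ultimately show ?thesis by (simp add: sB)
qed

lemma (in prob_space) tendsto_prob_compl:
  assumes A: "\<And>k::nat. A k \<in> events" and B: "B \<in> events" and lim: "(\<lambda>k. prob (A k \<inter> B)) \<longlonglongrightarrow> l * prob B"
  shows "(\<lambda>k. prob ((space M - A k) \<inter> B)) \<longlonglongrightarrow> (1 - l) * prob B"
proof -
  have "prob ((space M - A k) \<inter> B) = prob B - prob (A k \<inter> B)" for k
  proof -
    have "(space M - A k) \<inter> B = B - A k \<inter> B" using B sets.sets_into_space by auto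
    then show ?thesis using A B by (simp add: finite_measure_Diff)
  qed
  then show ?thesis using tendsto_diff[OF tendsto_const lim, of "prob B"] by (simp add: left_diff_distrib)
qed

text \<open>Index 0 of the past is the most recent map, so \<open>bwd\<close> along
  \<open>past w\<close> has \<open>w (-1)\<close> outermost, and a shift by one prepends a new
  outermost map.\<close>

definition past :: "(int \<Rightarrow> 'a) \<Rightarrow> nat \<Rightarrow> 'a" where
  "past w n = w (- 1 - int n)"

definition future :: "(int \<Rightarrow> 'a) \<Rightarrow> nat \<Rightarrow> 'a" where
  "future w n = w (int n)"

definition left_shift :: "nat \<Rightarrow> (int \<Rightarrow> 'a) \<Rightarrow> int \<Rightarrow> 'a" where
  "left_shift k w i = w (i + int k)"

definition glue :: "(nat \<Rightarrow> 'a) \<times> (nat \<Rightarrow> 'a) \<Rightarrow> int \<Rightarrow> 'a" where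
  "glue p i = (if 0 \<le> i then snd p (nat i) else fst p (nat (- 1 - i)))"

lemma past_glue [simp]: "past (glue p) = fst p"
  by (auto simp: past_def glue_def)

lemma future_glue [simp]: "future (glue p) = snd p"
  by (auto simp: future_def glue_def)

lemma shift_shift [simp]: "left_shift k (left_shift l w) = left_shift (k + l) w"
  by (auto simp: left_shift_def algebra_simps)

lemma shift_0 [simp]: "left_shift 0 w = w"
  by (auto simp: left_shift_def)

lemma shift_funpow: "left_shift 1 ^^ k = left_shift k"
  by (induction k) auto

lemma future_shift: "future (left_shift k w) n = future w (n + k)"
  by (simp add: future_def left_shift_def)

lemma past_shift_Suc: "past (left_shift (Suc k) w) = case_nat (future w k) (past (left_shift k w))"
  by (auto simp: past_def future_def left_shift_def split: nat.split intro!: ext arg_cong[of _ _ w])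

locale iid_sequences = prob_space M for M :: "'a measure"
begin

abbreviation WM :: "(int \<Rightarrow> 'a) measure" where "WM \<equiv> PiM UNIV (\<lambda>_. M)"
abbreviation PM :: "(nat \<Rightarrow> 'a) measure" where "PM \<equiv> PiM UNIV (\<lambda>_. M)"

sublocale W: product_prob_space "\<lambda>_. M" "UNIV :: int set" by unfold_locales
sublocale P: product_prob_space "\<lambda>_. M" "UNIV :: nat set" by unfold_locales

lemma distr_reindex:
  fixes f :: "'i \<Rightarrow> 'j"
  assumes "inj f"
  shows "distr (PiM UNIV (\<lambda>_. M)) (PiM UNIV (\<lambda>_. M)) (\<lambda>w i. w (f i)) = PiM UNIV (\<lambda>_. M)"
  using distr_PiM_reindex[of UNIV "\<lambda>_. M" f UNIV] assms prob_space_axioms by (simp add: restrict_UNIV)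

lemma measurable_reindex:
  "(\<lambda>w i. w (f i)) \<in> measurable (PiM UNIV (\<lambda>_. M)) (PiM UNIV (\<lambda>_. M))"
  by (rule measurable_PiM_single') (auto simp: space_PiM)

lemma measurable_past [measurable]: "past \<in> measurable WM PM"
  and measurable_future [measurable]: "future \<in> measurable WM PM"
  and measurable_shift [measurable]: "left_shift k \<in> measurable WM WM"
  unfolding past_def[abs_def] future_def[abs_def] left_shift_def[abs_def] by (rule measurable_reindex)+

lemma distr_past: "distr WM PM past = PM"
  unfolding past_def[abs_def] by (rule distr_reindex) (auto simp: inj_on_def)

lemma distr_future: "distr WM PM future = PM"
  unfolding future_def[abs_def] by (rule distr_reindex) (auto simp: inj_on_def)

lemma distr_shift: "distr WM WM (left_shift k) = WM"
  unfolding left_shift_def[abs_def] by (rule distr_reindex) (auto simp: inj_on_def)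

lemma distr_reflect: "distr WM WM (\<lambda>w i. w (- i)) = WM"
  by (rule distr_reindex) (auto simp: inj_on_def)

lemma measurable_glue [measurable]: "glue \<in> measurable (PM \<Otimes>\<^sub>M PM) WM"
proof (rule measurable_PiM_single')
  fix i :: int
  show "(\<lambda>p. glue p i) \<in> measurable (PM \<Otimes>\<^sub>M PM) M"
    by (cases "i \<ge> 0") (simp_all add: glue_def)
qed (auto simp: space_PiM space_pair_measure glue_def PiE_iff)

text \<open>This is the independence of past and future. Under \<open>glue\<close> a cylinder pulls
  back to a rectangle, and its product of probabilities splits into the negative and the nonnegative
  coordinates.\<close>

lemma distr_glue: "distr (PM \<Otimes>\<^sub>M PM) WM glue = WM"
proof (rule W.PiM_eq)
  fix J :: "int set" and F :: "int \<Rightarrow> 'a set"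
  assume J: "finite J" and F: "\<And>j. j \<in> J \<Longrightarrow> F j \<in> sets M"
  \<comment> \<open>\<open>q\<close> lists the negative integers in the order used by
    \<open>past\<close>.\<close>
  define q where "q = (\<lambda>n. - 1 - int n)"
  have injq: "inj_on q A" "inj_on int A" for A by (auto simp: q_def inj_on_def)
  define Jp where "Jp = q -` J"
  define Jf where "Jf = int -` J"
  have fin: "finite Jp" "finite Jf" using J by (auto simp: Jp_def Jf_def finite_vimageI injq)
  have JJ: "J = q ` Jp \<union> int ` Jf"
  proof safe
    fix j assume j: "j \<in> J" "j \<notin> int ` Jf"
    then have "j < 0" unfolding Jf_def by (metis image_eqI int_nat_eq linorder_not_less vimage_eq zero_le_imp_eq_int)
    then have "j = q (nat (-1 - j))" by (auto simp: q_def)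
    then show "j \<in> q ` Jp" using j by (metis Jp_def image_eqI vimage_eq)
  qed (auto simp: Jp_def Jf_def)
  have disj: "q ` Jp \<inter> int ` Jf = {}" by (auto simp: q_def)
  let ?A = "{x\<in>space PM. \<forall>i\<in>Jp. x i \<in> F (q i)}" and ?B = "{x\<in>space PM. \<forall>i\<in>Jf. x i \<in> F (int i)}"
  have FJ: "i \<in> Jp \<Longrightarrow> F (q i) \<in> sets M" "i \<in> Jf \<Longrightarrow> F (int i) \<in> sets M" for i
    using F by (auto simp: Jp_def Jf_def)
  have AB: "?A \<in> sets PM" "?B \<in> sets PM"
    using fin FJ by (auto intro!: sets.sets_Collect_finite_All sets_Collect_single')
  have gl: "glue p (q i) = fst p i" "glue p (int i) = snd p i" for p i
    by (auto simp: glue_def q_def)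
  have pre: "glue -` prod_emb UNIV (\<lambda>_. M) J (Pi\<^sub>E J F) \<inter> space (PM \<Otimes>\<^sub>M PM) = ?A \<times> ?B"
  proof -
    have "p \<in> space (PM \<Otimes>\<^sub>M PM) \<Longrightarrow> glue p \<in> prod_emb UNIV (\<lambda>_. M) J (Pi\<^sub>E J F) \<longleftrightarrow> (\<forall>j\<in>J. glue p j \<in> F j)" for p
      using measurable_space[OF measurable_glue, of p]
      by (auto simp: prod_emb_def space_PiM PiE_iff restrict_def extensional_def)
    then show ?thesis
      unfolding JJ by (auto simp: gl space_pair_measure ball_Un)
  qed
  have "prod_emb UNIV (\<lambda>_. M) J (Pi\<^sub>E J F) \<in> sets WM"
    using J F by (intro sets_PiM_I) auto
  from emeasure_distr[OF measurable_glue this]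
  have "emeasure (distr (PM \<Otimes>\<^sub>M PM) WM glue) (prod_emb UNIV (\<lambda>_. M) J (Pi\<^sub>E J F)) = emeasure (PM \<Otimes>\<^sub>M PM) (?A \<times> ?B)"
    unfolding pre .
  also have "\<dots> = emeasure PM ?A * emeasure PM ?B"
    by (rule P.P.emeasure_pair_measure_Times[OF AB])
  also have "emeasure PM ?A = (\<Prod>i\<in>Jp. emeasure M (F (q i)))"
    using fin FJ by (intro P.emeasure_PiM_Collect) auto
  also have "emeasure PM ?B = (\<Prod>i\<in>Jf. emeasure M (F (int i)))"
    using fin FJ by (intro P.emeasure_PiM_Collect) auto
  also have "(\<Prod>i\<in>Jp. emeasure M (F (q i))) * (\<Prod>i\<in>Jf. emeasure M (F (int i))) = (\<Prod>j\<in>J. emeasure M (F j))"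
    unfolding JJ prod.union_disjoint[OF finite_imageI[OF fin(1)] finite_imageI[OF fin(2)] disj]
      prod.reindex[OF injq(1)] prod.reindex[OF injq(2)] comp_def ..
  finally show "emeasure (distr (PM \<Otimes>\<^sub>M PM) WM glue) (prod_emb UNIV (\<lambda>_. M) J (Pi\<^sub>E J F)) = (\<Prod>j\<in>J. emeasure M (F j))" .
qed simp

text \<open>A large shift moves the finitely many coordinates that determine \<open>A\<close> away
  from those that determine \<open>B\<close>, so the two events become exactly independent.\<close>

lemma cylinder_mixing:
  assumes A: "A \<in> prod_algebra (UNIV :: int set) (\<lambda>_. M)" and B: "B \<in> prod_algebra (UNIV :: int set) (\<lambda>_. M)"
  shows "\<forall>\<^sub>F k in sequentially. measure WM ((left_shift k -` A \<inter> space WM) \<inter> B) = measure WM A * measure WM B"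
proof -
  obtain J E where A': "A = prod_emb UNIV (\<lambda>_. M) J (Pi\<^sub>E J E)" "finite J" "\<And>i. i \<in> J \<Longrightarrow> E i \<in> sets M"
    using prod_algebraE[OF A] by metis
  obtain K F where B': "B = prod_emb UNIV (\<lambda>_. M) K (Pi\<^sub>E K F)" "finite K" "\<And>i. i \<in> K \<Longrightarrow> F i \<in> sets M"
    using prod_algebraE[OF B] by metis
  have emb: "prod_emb UNIV (\<lambda>_. M) J (Pi\<^sub>E J E) = {w\<in>space WM. \<forall>i\<in>J. w i \<in> E i}" for J :: "int set" and E
    by (auto simp: prod_emb_def space_PiM PiE_iff)
  obtain b where b: "\<And>i. i \<in> J \<union> K \<Longrightarrow> \<bar>i\<bar> \<le> b"
    using bdd_above_finite[of "abs ` (J \<union> K)"] A'(2) B'(2) unfolding bdd_above_def by auto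
  show ?thesis
  proof (rule eventually_sequentiallyI)
    \<comment> \<open>All coordinates involved lie in \<open>[-b, b]\<close>, so a shift by more
      than \<open>2 * b\<close> separates the two sets.\<close>
    fix k assume k: "k \<ge> nat (2 * b + 1)"
    let ?s = "\<lambda>i. i + int k"
    let ?G = "\<lambda>i. if i \<in> K then F i else E (i - int k)"
    have disj: "i + int k \<notin> K" if "i \<in> J" for i
    proof
      assume "i + int k \<in> K"
      then have "\<bar>i + int k\<bar> \<le> b" "\<bar>i\<bar> \<le> b" using b that by auto
      with k show False by linarith
    qed
    have "(left_shift k -` A \<inter> space WM) \<inter> B = {w\<in>space WM. \<forall>i\<in>?s ` J \<union> K. w i \<in> ?G i}"
      unfolding A' B' emb using disj measurable_space[OF measurable_shift[of k]]
      by (auto simp: left_shift_def ball_Un)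
    also have "\<dots> = prod_emb UNIV (\<lambda>_. M) (?s ` J \<union> K) (Pi\<^sub>E (?s ` J \<union> K) ?G)" by (simp only: emb)
    also have "measure WM \<dots> = (\<Prod>i\<in>?s ` J \<union> K. measure M (?G i))"
      using A' B' disj by (intro W.measure_PiM_emb) auto
    also have "\<dots> = (\<Prod>i\<in>?s ` J. measure M (?G i)) * (\<Prod>i\<in>K. measure M (?G i))"
      using A' B' disj by (intro prod.union_disjoint) auto
    also have "(\<Prod>i\<in>?s ` J. measure M (?G i)) = (\<Prod>i\<in>J. measure M (E i))"
      using disj by (subst prod.reindex) (auto simp: inj_on_def intro!: prod.cong)
    also have "\<dots> = measure WM A"
      unfolding A' using A' by (intro W.measure_PiM_emb[symmetric]) auto
    also have "(\<Prod>i\<in>K. measure M (?G i)) = measure WM B"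
      unfolding B' using B' by (subst W.measure_PiM_emb) auto
    finally show "measure WM ((left_shift k -` A \<inter> space WM) \<inter> B) = measure WM A * measure WM B" .
  qed
qed

text \<open>Two Dynkin inductions: the first extends \<open>B\<close> from cylinders to all events
  with \<open>A\<close> still a cylinder, the second then extends \<open>A\<close>.\<close>

lemma shift_mixing:
  assumes A: "A \<in> sets WM" and B: "B \<in> sets WM"
  shows "(\<lambda>k. measure WM ((left_shift k -` A \<inter> space WM) \<inter> B)) \<longlonglongrightarrow> measure WM A * measure WM B"
proof -
  let ?\<Omega> = "\<Pi>\<^sub>E i\<in>UNIV::int set. space M"
  let ?G = "prod_algebra (UNIV::int set) (\<lambda>_. M)"
  have sW: "sets WM = sigma_sets ?\<Omega> ?G" by (rule sets_PiM)
  have \<Omega>: "space WM = ?\<Omega>" by (rule space_PiM)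
  have pre: "left_shift k -` A \<inter> space WM \<in> sets WM" "measure WM (left_shift k -` A \<inter> space WM) = measure WM A"
    if "A \<in> sets WM" for k A
  proof -
    show "left_shift k -` A \<inter> space WM \<in> sets WM" using measurable_sets[OF measurable_shift that] .
    show "measure WM (left_shift k -` A \<inter> space WM) = measure WM A"
      using measure_distr[OF measurable_shift[of k] that] by (simp add: distr_shift)
  qed
  have G: "A \<in> ?G \<Longrightarrow> A \<in> sets WM" for A unfolding sW by (rule sigma_sets.Basic)
  have 1: "(\<lambda>k. measure WM ((left_shift k -` A \<inter> space WM) \<inter> B)) \<longlonglongrightarrow> measure WM A * measure WM B"
    if A: "A \<in> ?G" and B: "B \<in> sets WM" for A B
    using Int_stable_prod_algebra prod_algebra_sets_into_space B[unfolded sW]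
  proof (induction rule: sigma_sets_induct_disjoint)
    case (basic B)
    then show ?case by (intro tendsto_eventually cylinder_mixing A)
  next
    case (compl B)
    have B: "B \<in> sets WM" using compl by (simp add: sW)
    have *: "(left_shift k -` A \<inter> space WM) \<inter> (?\<Omega> - B) = (space WM - B) \<inter> (left_shift k -` A \<inter> space WM)" for k
      by (auto simp: \<Omega>)
    have "measure WM ((left_shift k -` A \<inter> space WM) \<inter> (?\<Omega> - B)) = measure WM A - measure WM ((left_shift k -` A \<inter> space WM) \<inter> B)" for k
    proof -
      have "(left_shift k -` A \<inter> space WM) \<inter> (?\<Omega> - B) = (left_shift k -` A \<inter> space WM) - ((left_shift k -` A \<inter> space WM) \<inter> B)"
        by (auto simp: \<Omega>)
      moreover have "measure WM \<dots> = measure WM (left_shift k -` A \<inter> space WM) - measure WM ((left_shift k -` A \<inter> space WM) \<inter> B)"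
        by (rule W.P.finite_measure_Diff[OF pre(1)[OF G[OF A]] sets.Int[OF pre(1)[OF G[OF A]] B]]) blast
      ultimately show ?thesis unfolding pre(2)[OF G[OF A]] by (simp only:)
    qed
    moreover have "measure WM (?\<Omega> - B) = 1 - measure WM B"
      using W.P.prob_compl[OF B] by (simp add: \<Omega>)
    moreover have "(\<lambda>k. measure WM A - measure WM ((left_shift k -` A \<inter> space WM) \<inter> B)) \<longlonglongrightarrow> measure WM A - measure WM A * measure WM B"
      by (intro tendsto_diff tendsto_const compl(2))
    ultimately show ?case by (simp only: right_diff_distrib mult_1_right)
  next
    case (union B)
    have B: "range B \<subseteq> sets WM" using union by (simp add: sW)
    have "(\<lambda>k. measure WM (\<Union>i. (left_shift k -` A \<inter> space WM) \<inter> B i)) \<longlonglongrightarrow> measure WM (\<Union>i. B i) * measure WM A"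
    proof (rule W.P.tendsto_prob_UN[OF B union(1)])
      show "range (\<lambda>i. left_shift k -` A \<inter> space WM \<inter> B i) \<subseteq> sets WM" for k
        using sets.Int[OF pre(1)[OF G[OF A], of k]] B by blast
      show "disjoint_family (\<lambda>i. left_shift k -` A \<inter> space WM \<inter> B i)" for k
        using union(1) by (auto simp: disjoint_family_on_def)
      show "measure WM (left_shift k -` A \<inter> space WM \<inter> B i) \<le> measure WM (B i)" for k i
        using B by (intro W.P.finite_measure_mono) blast+
      show "(\<lambda>k. measure WM (left_shift k -` A \<inter> space WM \<inter> B i)) \<longlonglongrightarrow> measure WM (B i) * measure WM A" for i
        using union(3)[of i] by (simp add: mult.commute)
    qed
    then show ?case by (simp add: mult.commute)
  next
    case empty
    show ?case unfolding Int_empty_right measure_empty mult_zero_right by (rule tendsto_const)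
  qed
  show ?thesis
    using Int_stable_prod_algebra prod_algebra_sets_into_space A[unfolded sW]
  proof (induction rule: sigma_sets_induct_disjoint)
    case (basic A)
    then show ?case using 1 B by blast
  next
    case (compl A)
    have A: "A \<in> sets WM" using compl by (simp add: sW)
    have "left_shift k -` (?\<Omega> - A) \<inter> space WM \<inter> B = (space WM - (left_shift k -` A \<inter> space WM)) \<inter> B" for k
      using measurable_space[OF measurable_shift[of k]] by (auto simp: \<Omega>)
    moreover have "measure WM (?\<Omega> - A) = 1 - measure WM A"
      using W.P.prob_compl[OF A] by (simp add: \<Omega>)
    ultimately show ?case
      using W.P.tendsto_prob_compl[OF pre(1)[OF A] B compl(2)] by simp
  next
    case (union A)
    have A: "range A \<subseteq> sets WM" using union by (simp add: sW)
    have "(\<lambda>k. measure WM (\<Union>i. (left_shift k -` A i \<inter> space WM) \<inter> B)) \<longlonglongrightarrow> measure WM (\<Union>i. A i) * measure WM B"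
    proof (rule W.P.tendsto_prob_UN[OF A union(1)])
      show "range (\<lambda>i. left_shift k -` A i \<inter> space WM \<inter> B) \<subseteq> sets WM" for k
        using sets.Int[OF pre(1)[of _ k] B] A by blast
      show "disjoint_family (\<lambda>i. left_shift k -` A i \<inter> space WM \<inter> B)" for k
        using union(1) by (auto simp: disjoint_family_on_def)
      show "measure WM (left_shift k -` A i \<inter> space WM \<inter> B) \<le> measure WM (A i)" for k i
      proof -
        have Ai: "A i \<in> sets WM" using A by auto
        have "measure WM (left_shift k -` A i \<inter> space WM \<inter> B) \<le> measure WM (left_shift k -` A i \<inter> space WM)"
          using pre(1)[OF Ai, of k] by (intro W.P.finite_measure_mono) blast+
        with pre(2)[OF Ai, of k] show ?thesis by simp
      qed
      show "(\<lambda>k. measure WM (left_shift k -` A i \<inter> space WM \<inter> B)) \<longlonglongrightarrow> measure WM (A i) * measure WM B" for i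
        using union(3)[of i] .
    qed
    moreover have "(\<Union>i. (left_shift k -` A i \<inter> space WM) \<inter> B) = left_shift k -` (\<Union>i. A i) \<inter> space WM \<inter> B" for k by auto
    ultimately show ?case by (simp only:)
  next
    case empty
    show ?case unfolding vimage_empty Int_empty_left measure_empty mult_zero_left by (rule tendsto_const)
  qed
qed

text \<open>Mixing of an invariant event with itself makes its measure equal to its own
  square.\<close>

lemma ergodic_shift: "ergodic_map WM (left_shift 1)"
  unfolding ergodic_map_def
proof (intro conjI ballI impI measurable_shift distr_shift)
  fix A assume A: "A \<in> sets WM" and inv: "\<forall>w\<in>space WM. left_shift 1 w \<in> A \<longleftrightarrow> w \<in> A"
  have "left_shift k w \<in> A \<longleftrightarrow> w \<in> A" if "w \<in> space WM" for k w
  proof (induction k)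
    case (Suc k)
    have "left_shift k w \<in> space WM" using that measurable_space[OF measurable_shift] by blast
    with inv[rule_format, of "left_shift k w"] Suc show ?case by simp
  qed simp
  then have "left_shift k -` A \<inter> space WM \<inter> A = A" for k
    using sets.sets_into_space[OF A] by auto
  with shift_mixing[OF A A] have "measure WM A = measure WM A * measure WM A"
    by (simp add: LIMSEQ_const_iff)
  then show "measure WM A \<in> {0, 1}" by auto
qed

theorem birkhoff_shift:
  fixes G :: "(int \<Rightarrow> 'a) \<Rightarrow> real"
  assumes "integrable WM G"
  shows "AE w in WM. (\<lambda>n. (\<Sum>j<n. G (left_shift j w)) / real n) \<longlonglongrightarrow> (\<integral>w. G w \<partial>WM)"
  using W.P.birkhoff_ergodic[OF ergodic_shift assms] unfolding shift_funpow .

lemma AE_future: "AE \<omega> in PM. Q \<omega> \<Longrightarrow> AE w in WM. Q (future w)"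
  by (rule AE_distrD[OF measurable_future]) (unfold distr_future)

lemma AE_past: "AE \<omega> in PM. Q \<omega> \<Longrightarrow> AE w in WM. Q (past w)"
  by (rule AE_distrD[OF measurable_past]) (unfold distr_past)

lemma AE_shift: "AE w in WM. Q w \<Longrightarrow> AE w in WM. \<forall>k. Q (left_shift k w)"
  unfolding AE_all_countable by (intro allI AE_distrD[OF measurable_shift]) (unfold distr_shift)

text \<open>Fubini for the splitting into past and future. It later allows a random starting point
  read off from the past to be replaced by a fixed one.\<close>

lemma AE_glue:
  assumes "AE w in WM. Q (past w) (future w)"
  shows "AE \<omega>' in PM. AE \<omega> in PM. Q \<omega>' \<omega>"
proof -
  interpret pair_sigma_finite PM PM ..
  have "AE w in distr (PM \<Otimes>\<^sub>M PM) WM glue. Q (past w) (future w)" unfolding distr_glue by (rule assms)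
  from AE_distrD[OF measurable_glue this] have "AE p in PM \<Otimes>\<^sub>M PM. Q (fst p) (snd p)" by simp
  from AE_pair[OF this] show ?thesis by simp
qed

text \<open>The reflection of the index preserves the measure, fixes coordinate 0 and exchanges the
  coordinates \<open>1, 2, ...\<close> with \<open>-1, -2, ...\<close>. It converts integrals over
  the future into integrals over the past, as needed when time is reversed.\<close>

lemma integral_reflect:
  fixes G :: "'a \<Rightarrow> (nat \<Rightarrow> 'a) \<Rightarrow> real"
  assumes G: "(\<lambda>p. G (fst p) (snd p)) \<in> borel_measurable (M \<Otimes>\<^sub>M PM)"
  shows "(\<integral>w. G (w 0) (future (left_shift 1 w)) \<partial>WM) = (\<integral>w. G (w 0) (past w) \<partial>WM)"
proof -
  define r :: "(int \<Rightarrow> 'a) \<Rightarrow> int \<Rightarrow> 'a" where "r = (\<lambda>w i. w (- i))"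
  define g where "g = (\<lambda>w::int \<Rightarrow> 'a. G (w 0) (past w))"
  have w0: "(\<lambda>w. w 0) \<in> measurable WM M"
    by (rule measurable_component_singleton) simp
  have g: "g \<in> borel_measurable WM"
    using measurable_compose[OF measurable_Pair[OF w0 measurable_past] G] by (simp add: g_def)
  have r: "r \<in> measurable WM WM" unfolding r_def by (rule measurable_reindex)
  have "g (r w) = G (w 0) (future (left_shift 1 w))" for w
  proof -
    have "past (r w) = future (left_shift 1 w)"
      by (auto simp: past_def future_def left_shift_def r_def add.commute)
    then show ?thesis by (simp add: g_def r_def)
  qed
  then have "(\<integral>w. G (w 0) (future (left_shift 1 w)) \<partial>WM) = (\<integral>w. g (r w) \<partial>WM)" by (simp only:)
  also have "\<dots> = (\<integral>w. g w \<partial>distr WM WM r)"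
    using r g by (rule integral_distr[symmetric])
  also have "distr WM WM r = WM" unfolding r_def by (rule distr_reflect)
  finally show ?thesis unfolding g_def .
qed

end

section \<open>Lifts of circle diffeomorphisms\<close>

lemma dS1_le: "dS1 x y \<le> \<bar>x - y - of_int l\<bar>"
proof (cases "of_int l \<le> x - y")
  case True
  then have "l \<le> \<lfloor>x - y\<rfloor>" by (simp add: le_floor_iff)
  then have "real_of_int l \<le> of_int \<lfloor>x - y\<rfloor>" by simp
  then show ?thesis unfolding dS1_def frac_def using True by linarith
next
  case False
  then have "\<lfloor>x - y\<rfloor> + 1 \<le> l" by linarith
  then have "real_of_int (\<lfloor>x - y\<rfloor> + 1) \<le> of_int l" by (simp only: of_int_le_iff)
  then show ?thesis unfolding dS1_def frac_def using False by (simp, linarith?)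
qed

text \<open>Together with \<open>dS1_le\<close> this identifies \<open>dS1 x y\<close> as the
  distance of \<open>x - y\<close> to the nearest integer; the metric laws follow from that without
  handling \<open>frac\<close>.\<close>

lemma dS1_attained: obtains l :: int where "dS1 x y = \<bar>x - y - of_int l\<bar>"
proof (cases "frac (x - y) \<le> 1 - frac (x - y)")
  case True
  then have "dS1 x y = \<bar>x - y - of_int \<lfloor>x - y\<rfloor>\<bar>" unfolding dS1_def frac_def by linarith
  then show ?thesis by (rule that)
next
  case False
  then have "dS1 x y = \<bar>x - y - of_int (\<lfloor>x - y\<rfloor> + 1)\<bar>" unfolding dS1_def frac_def by (simp, linarith?)
  then show ?thesis by (rule that)
qed

lemma dS1_nonneg: "0 \<le> dS1 x y"
  unfolding dS1_def using frac_ge_0[of "x - y"] frac_lt_1[of "x - y"] by simp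

lemma dS1_le_half: "dS1 x y \<le> 1/2"
  unfolding dS1_def by linarith

lemma dS1_le_abs: "dS1 x y \<le> \<bar>x - y\<bar>"
  using dS1_le[of x y 0] by simp

lemma dS1_commute: "dS1 x y = dS1 y x"
proof -
  have "dS1 x y \<le> dS1 y x" for x y
  proof -
    obtain l where "dS1 y x = \<bar>y - x - of_int l\<bar>" by (rule dS1_attained)
    with dS1_le[of x y "-l"] show ?thesis by simp
  qed
  from this[of x y] this[of y x] show ?thesis by linarith
qed

lemma dS1_triangle: "dS1 x z \<le> dS1 x y + dS1 y z"
proof -
  obtain k where k: "dS1 x y = \<bar>x - y - of_int k\<bar>" by (rule dS1_attained)
  obtain l where l: "dS1 y z = \<bar>y - z - of_int l\<bar>" by (rule dS1_attained)
  from dS1_le[of x z "k + l"] k l show ?thesis by simp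
qed

lemma dS1_eq_0_iff: "dS1 x y = 0 \<longleftrightarrow> circ_eq x y"
proof
  assume *: "dS1 x y = 0"
  obtain l where "dS1 x y = \<bar>x - y - of_int l\<bar>" by (rule dS1_attained)
  with * have "x - y = of_int l" by simp
  then show "circ_eq x y" unfolding circ_eq_def by simp
next
  assume "circ_eq x y"
  then obtain l where "x - y = of_int l" unfolding circ_eq_def by (auto elim: Ints_cases)
  with dS1_le[of x y l] dS1_nonneg[of x y] show "dS1 x y = 0" by simp
qed

lemma circ_eq_refl [simp]: "circ_eq x x"
  by (simp add: circ_eq_def)

lemma circ_eq_sym: "circ_eq x y \<Longrightarrow> circ_eq y x"
  by (metis dS1_commute dS1_eq_0_iff)

lemma circ_eq_trans [trans]: "circ_eq x y \<Longrightarrow> circ_eq y z \<Longrightarrow> circ_eq x z"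
  using dS1_triangle[of x z y] dS1_nonneg[of x z] by (auto simp flip: dS1_eq_0_iff)

lemma circ_eq_add_int: "circ_eq (x + of_int l) x"
  by (simp add: circ_eq_def)

lemma circ_eqE:
  assumes "circ_eq x y" obtains l :: int where "x = y + of_int l"
proof -
  from assms obtain l where "x - y = of_int l" unfolding circ_eq_def by (auto elim: Ints_cases)
  then show ?thesis by (intro that[of l]) simp
qed

lemma dS1_cong: "circ_eq x x' \<Longrightarrow> circ_eq y y' \<Longrightarrow> dS1 x y = dS1 x' y'"
  using dS1_triangle[of x y x'] dS1_triangle[of x' y y'] dS1_triangle[of x' y' x] dS1_triangle[of x y' y]
  by (simp add: dS1_commute flip: dS1_eq_0_iff)

lemma dS1_tendsto_unique:
  assumes "(\<lambda>n. dS1 (u n) a) \<longlonglongrightarrow> 0" "(\<lambda>n. dS1 (u n) b) \<longlonglongrightarrow> 0"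
  shows "circ_eq a b"
proof -
  have "dS1 a b \<le> dS1 (u n) a + dS1 (u n) b" for n
    using dS1_triangle[of a b "u n"] by (simp add: dS1_commute)
  then have "dS1 a b \<le> 0 + 0"
    by (intro LIMSEQ_le_const[OF tendsto_add[OF assms]]) auto
  with dS1_nonneg[of a b] show ?thesis by (simp flip: dS1_eq_0_iff)
qed

text \<open>The complement of a ball about \<open>t\<close> is unrolled to a single interval of the
  line, where the intermediate and mean value theorems apply.\<close>

lemma dS1_ge_imp_arc:
  assumes "\<delta> \<le> dS1 x t"
  obtains l :: int where "t + \<delta> \<le> x + of_int l" "x + of_int l \<le> t + 1 - \<delta>"
proof (rule that[of "- \<lfloor>x - t\<rfloor>"])
  have "\<delta> \<le> frac (x - t)" "\<delta> \<le> 1 - frac (x - t)" using assms unfolding dS1_def by linarith+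
  then show "t + \<delta> \<le> x + of_int (- \<lfloor>x - t\<rfloor>)" "x + of_int (- \<lfloor>x - t\<rfloor>) \<le> t + 1 - \<delta>"
    unfolding frac_def by linarith+
qed

lemma arc_imp_dS1_ge:
  assumes "t + \<delta> \<le> x" "x \<le> t + 1 - \<delta>" "0 < \<delta>"
  shows "\<delta> \<le> dS1 x t"
proof -
  have "frac (x - t) = x - t" using assms by (simp add: frac_eq)
  with assms show ?thesis unfolding dS1_def by linarith
qed

section \<open>Periodic functions and lifts of circle maps\<close>

lemma periodic_int:
  fixes g :: "real \<Rightarrow> 'a"
  assumes "\<And>x. g (x + 1) = g x"
  shows "g (x + of_int l) = g x"
proof -
  have nat: "g (x + real n) = g x" for x n
  proof (induction n)
    case (Suc n)
    have "g (x + real (Suc n)) = g ((x + real n) + 1)" by (simp add: add_ac)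
    also have "\<dots> = g x" using assms Suc by simp
    finally show ?case .
  qed simp
  show ?thesis
  proof (cases "l \<ge> 0")
    case True
    then show ?thesis using nat[of x "nat l"] by simp
  next
    case False
    then show ?thesis using nat[of "x + of_int l" "nat (-l)"] by simp
  qed
qed

lemma periodic_circ_eq:
  assumes "\<And>x. g (x + 1) = g x" "circ_eq x y"
  shows "g x = g y"
  using assms(2) periodic_int[where g=g] assms(1) by (metis circ_eqE)

lemma periodic_range:
  fixes g :: "real \<Rightarrow> 'a"
  assumes "\<And>x. g (x + 1) = g x"
  shows "range g = g ` {0..1}"
proof safe
  fix x :: real
  have "g x = g (frac x)"
    using periodic_int[where g=g, of "frac x" "\<lfloor>x\<rfloor>"] assms by (simp add: frac_def)
  moreover have "frac x \<in> {0..1}" using frac_lt_1[of x] by (simp add: less_imp_le)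
  ultimately show "g x \<in> g ` {0..1}" by blast
qed auto

lemma periodic_uniformly_continuous:
  fixes g :: "real \<Rightarrow> real"
  assumes per: "\<And>x. g (x + 1) = g x" and cont: "continuous_on UNIV g" and e: "e > 0"
  obtains d where "d > 0" "\<And>x y. \<bar>x - y\<bar> < d \<Longrightarrow> \<bar>g x - g y\<bar> < e"
proof -
  \<comment> \<open>Translating \<open>x\<close> into \<open>[0, 1)\<close> puts every point at
    distance less than 1 from it into \<open>[-1, 2]\<close>; this is also why the radius is capped
    by 1 below.\<close>
  have "uniformly_continuous_on {-1..2} g"
    using cont by (intro compact_uniformly_continuous) (auto intro: continuous_on_subset)
  then obtain d where d: "d > 0" "\<And>x y. x \<in> {-1..2} \<Longrightarrow> y \<in> {-1..2} \<Longrightarrow> dist y x < d \<Longrightarrow> dist (g y) (g x) < e"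
    using e unfolding uniformly_continuous_on_def by metis
  have "\<bar>g x - g y\<bar> < e" if "\<bar>x - y\<bar> < min d 1" for x y
  proof -
    let ?l = "- \<lfloor>x\<rfloor>"
    have "dist (g (x + of_int ?l)) (g (y + of_int ?l)) < e"
      using that by (intro d(2)) (auto simp: dist_real_def, linarith+)
    then show ?thesis unfolding periodic_int[where g=g, OF per] dist_real_def by simp
  qed
  with d(1) show ?thesis by (intro that[of "min d 1"]) auto
qed

text \<open>This class is closed under composition and inversion, unlike the lifts normalised by
  \<open>0 \<le> F 0 < 1\<close>.\<close>

definition circle_lift :: "(real \<Rightarrow> real) \<Rightarrow> bool" where
  "circle_lift F \<longleftrightarrow> bij F \<and> (\<forall>x. F differentiable (at x)) \<and> continuous_on UNIV (deriv F)
      \<and> (\<forall>x. deriv F x \<noteq> 0) \<and> ((\<forall>x. F (x + 1) = F x + 1) \<or> (\<forall>x. F (x + 1) = F x - 1))"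

lemma Diff1tau_circle_lift: "F \<in> Diff1tau \<tau> \<Longrightarrow> circle_lift F"
  by (simp add: Diff1tau_def circle_lift_def)

context
  fixes F :: "real \<Rightarrow> real"
  assumes F: "circle_lift F"
begin

lemma circle_lift_bij: "bij F"
  using F by (simp add: circle_lift_def)

lemma circle_lift_f_inv [simp]: "F (inv F x) = x"
  by (simp add: bij_is_surj[OF circle_lift_bij] surj_f_inv_f)

lemma circle_lift_inv_f [simp]: "inv F (F x) = x"
  by (simp add: bij_is_inj[OF circle_lift_bij])

lemma circle_lift_DERIV: "(F has_real_derivative deriv F x) (at x)"
  using F by (simp add: circle_lift_def DERIV_deriv_iff_real_differentiable)

lemma circle_lift_isCont: "isCont F x"
  by (rule DERIV_isCont[OF circle_lift_DERIV])

lemma circle_lift_continuous: "continuous_on A F"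
  by (simp add: circle_lift_isCont continuous_at_imp_continuous_on)

lemma circle_lift_deriv_nz: "deriv F x \<noteq> 0"
  using F by (simp add: circle_lift_def)

lemma circle_lift_deriv_continuous: "continuous_on A (deriv F)"
  using F unfolding circle_lift_def by (auto intro: continuous_on_subset)

lemma circle_lift_degree: obtains s :: int where "s = 1 \<or> s = -1" "\<And>x l. F (x + of_int l) = F x + of_int (s * l)"
proof -
  have "(\<forall>x. F (x + 1) = F x + 1) \<or> (\<forall>x. F (x + 1) = F x - 1)" using F by (simp add: circle_lift_def)
  then show ?thesis
  proof
    assume "\<forall>x. F (x + 1) = F x + 1"
    then have "F (x + of_int l) - (x + of_int l) = F x - x" for x l
      by (intro periodic_int[where g="\<lambda>x. F x - x"]) auto
    then have "F (x + of_int l) = F x + of_int (1 * l)" for x l by (simp add: algebra_simps)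
    then show ?thesis by (intro that[of 1]) auto
  next
    assume "\<forall>x. F (x + 1) = F x - 1"
    then have "F (x + of_int l) + (x + of_int l) = F x + x" for x l
      by (intro periodic_int[where g="\<lambda>x. F x + x"]) auto
    then have "F (x + of_int l) = F x + of_int (-1 * l)" for x l by (simp add: algebra_simps eq_diff_eq)
    then show ?thesis by (intro that[of "-1"]) auto
  qed
qed

lemma circle_lift_circ_eq: "circ_eq x y \<Longrightarrow> circ_eq (F x) (F y)"
  by (erule circ_eqE, rule circle_lift_degree) (auto simp: circ_eq_def)

lemma circle_lift_deriv_periodic: "deriv F (x + 1) = deriv F x"
proof -
  obtain s :: int where s: "\<And>x l. F (x + of_int l) = F x + of_int (s * l)" by (rule circle_lift_degree) metis
  have "((\<lambda>x. F (x + 1)) has_real_derivative deriv F (x + 1)) (at x)"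
    using circle_lift_DERIV[of "x+1"] by (simp add: DERIV_shift)
  moreover have "((\<lambda>x. F (x + 1)) has_real_derivative deriv F x) (at x)"
    using s[of _ 1] circle_lift_DERIV[of x] by (auto intro!: derivative_eq_intros)
  ultimately show ?thesis by (rule DERIV_unique)
qed

lemma circle_lift_isCont_inv: "isCont (inv F) x"
  using isCont_inverse_function[of 1 "inv F x" "inv F" F] circle_lift_isCont by simp

lemma circle_lift_DERIV_inv: "(inv F has_real_derivative inverse (deriv F (inv F x))) (at x)"
  by (rule DERIV_inverse_function[where f=F and a="x-1" and b="x+1"])
     (auto simp: circle_lift_DERIV circle_lift_deriv_nz circle_lift_isCont_inv)

lemma circle_lift_deriv_inv: "deriv (inv F) x = inverse (deriv F (inv F x))"
  by (rule DERIV_imp_deriv[OF circle_lift_DERIV_inv])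

lemma circle_lift_inv: "circle_lift (inv F)"
  unfolding circle_lift_def
proof (intro conjI allI)
  show "bij (inv F)" by (rule bij_imp_bij_inv[OF circle_lift_bij])
  show "inv F differentiable at x" for x
    using circle_lift_DERIV_inv[of x] unfolding real_differentiable_def by blast
  have "continuous_on UNIV (inv F)"
    by (simp add: circle_lift_isCont_inv continuous_at_imp_continuous_on)
  from continuous_on_compose2[OF circle_lift_deriv_continuous[of UNIV] this]
  have "continuous_on UNIV (\<lambda>x. deriv F (inv F x))" by simp
  then show "continuous_on UNIV (deriv (inv F))"
    unfolding circle_lift_deriv_inv[abs_def] by (intro continuous_intros) (auto simp: circle_lift_deriv_nz)
  show "deriv (inv F) x \<noteq> 0" for x
    by (simp add: circle_lift_deriv_inv circle_lift_deriv_nz)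
  obtain s :: int where s: "s = 1 \<or> s = -1" "\<And>x l. F (x + of_int l) = F x + of_int (s * l)"
    by (rule circle_lift_degree) metis
  have "inv F (x + 1) = inv F x + of_int s" for x
  proof -
    have "F (inv F x + of_int s) = F (inv F (x + 1))" using s by auto
    then have "inv F (F (inv F x + of_int s)) = inv F (x + 1)" by simp
    then show ?thesis by simp
  qed
  with s(1) show "(\<forall>x. inv F (x + 1) = inv F x + 1) \<or> (\<forall>x. inv F (x + 1) = inv F x - 1)" by auto
qed

lemma circle_lift_mvt:
  assumes "a < b" obtains z where "a < z" "z < b" "F b - F a = (b - a) * deriv F z"
  using MVT2[OF assms, of F "deriv F"] circle_lift_DERIV by metis

lemma bdd_above_deriv: "bdd_above (range (\<lambda>z. \<bar>deriv F z\<bar>))"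
proof -
  have "compact ((\<lambda>z. \<bar>deriv F z\<bar>) ` {0..1})"
    by (intro compact_continuous_image continuous_intros circle_lift_deriv_continuous) auto
  then show ?thesis
    by (subst periodic_range) (auto simp: circle_lift_deriv_periodic bounded_imp_bdd_above compact_imp_bounded)
qed

lemma bdd_below_deriv: "bdd_below (range (\<lambda>z. \<bar>deriv F z\<bar>))"
  by (intro bdd_belowI[of _ 0]) auto

lemma abs_deriv_le_supder: "\<bar>deriv F x\<bar> \<le> supder F"
  unfolding supder_def by (rule cSUP_upper[OF UNIV_I bdd_above_deriv])

lemma infder_le_abs_deriv: "infder F \<le> \<bar>deriv F x\<bar>"
  unfolding infder_def by (rule cINF_lower[OF bdd_below_deriv UNIV_I])

lemma supder_pos: "supder F > 0"
  using abs_deriv_le_supder[of 0] circle_lift_deriv_nz[of 0] by linarith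

lemma infder_pos: "infder F > 0"
proof -
  obtain z where z: "\<forall>x\<in>{0..1}. \<bar>deriv F z\<bar> \<le> \<bar>deriv F x\<bar>"
    using continuous_attains_inf[of "{0..1::real}" "\<lambda>x. \<bar>deriv F x\<bar>"]
      continuous_on_rabs[OF circle_lift_deriv_continuous] by auto
  have "\<bar>deriv F z\<bar> \<le> infder F"
    unfolding infder_def
    by (subst periodic_range) (auto simp: circle_lift_deriv_periodic z intro!: cINF_greatest)
  with circle_lift_deriv_nz[of z] show ?thesis by linarith
qed

end

text \<open>A point of the arc mapped to a multiple of \<open>1 / m\<close> would be, modulo
  integers, a preimage of one of the \<open>m\<close> grid points and hence closer than
  \<open>\<delta>\<close> to \<open>t\<close>. So the image of the arc, being connected, stays
  between two consecutive multiples.\<close>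

lemma circle_lift_gap:
  fixes m :: nat
  assumes F: "circle_lift F" and m: "m > 0" and \<delta>: "\<delta> > 0" and near: "\<And>i. i < m \<Longrightarrow> dS1 (inv F (real i / real m)) t < \<delta>"
    and x: "t + \<delta> \<le> x" "x \<le> t + 1 - \<delta>" and y: "t + \<delta> \<le> y" "y \<le> t + 1 - \<delta>"
  shows "\<bar>F x - F y\<bar> \<le> 1 / real m"
proof -
  have avoid: "F p \<noteq> of_int k / real m" if p: "t + \<delta> \<le> p" "p \<le> t + 1 - \<delta>" for p k
  proof
    assume eq: "F p = of_int k / real m"
    \<comment> \<open>Reduction of \<open>k\<close> modulo \<open>m\<close> turns an arbitrary
      multiple of \<open>1 / m\<close> into one of the \<open>m\<close> grid points covered by
      \<open>near\<close>.\<close>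
    have "circ_eq (F p) (real (nat (k mod int m)) / real m)"
    proof -
      have "real_of_int k = of_int (k mod int m) + real m * of_int (k div int m)"
        by (metis mod_mult_div_eq of_int_add of_int_mult of_int_of_nat_eq)
      then have "F p - real (nat (k mod int m)) / real m = of_int (k div int m)"
        unfolding eq using m by (simp add: field_simps)
      then show ?thesis unfolding circ_eq_def by simp
    qed
    then have "circ_eq (inv F (F p)) (inv F (real (nat (k mod int m)) / real m))"
      by (rule circle_lift_circ_eq[OF circle_lift_inv[OF F]])
    then have "dS1 p t = dS1 (inv F (real (nat (k mod int m)) / real m)) t"
      by (intro dS1_cong) (simp_all add: circle_lift_inv_f[OF F])
    also have "\<dots> < \<delta>" using m by (intro near) (simp add: nat_less_iff)
    finally show False using arc_imp_dS1_ge[OF p \<delta>] by simp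
  qed
  have "F y \<le> F x + 1 / real m" if x: "t + \<delta> \<le> x" "x \<le> t + 1 - \<delta>" and y: "t + \<delta> \<le> y" "y \<le> t + 1 - \<delta>" for x y
  proof (rule ccontr)
    assume *: "\<not> ?thesis"
    \<comment> \<open>This is the first multiple of \<open>1 / m\<close> above \<open>F x\<close>;
      it does not exceed \<open>F x + 1 / m\<close> and is therefore crossed on the way to
      \<open>F y\<close>.\<close>
    define k where "k = \<lfloor>real m * F x\<rfloor> + 1"
    have "real m * F x \<le> of_int k" "of_int k \<le> real m * F x + 1" unfolding k_def by linarith+
    then have "F x \<le> of_int k / real m" "of_int k / real m \<le> F x + 1 / real m"
      using m by (simp_all add: field_simps)
    with * have k: "F x \<le> of_int k / real m" "of_int k / real m \<le> F y" by linarith+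
    have "\<exists>p\<in>closed_segment x y. F p = of_int k / real m"
      using k by (intro IVT'_closed_segment_real[OF _ circle_lift_continuous[OF F]])
        (auto simp: closed_segment_eq_real_ivl)
    then obtain p where "p \<in> closed_segment x y" "F p = of_int k / real m" by blast
    moreover from this have "t + \<delta> \<le> p" "p \<le> t + 1 - \<delta>"
      using x y by (auto simp: closed_segment_eq_real_ivl split: if_splits)
    ultimately show False using avoid by blast
  qed
  from this[OF x y] this[OF y x] show ?thesis by linarith
qed

lemma circle_lift_gap_dS1:
  fixes m :: nat
  assumes F: "circle_lift F" and "m > 0" "\<delta> > 0" "\<And>i. i < m \<Longrightarrow> dS1 (inv F (real i / real m)) t < \<delta>"
    and "\<delta> \<le> dS1 x t" "\<delta> \<le> dS1 y t"
  shows "dS1 (F x) (F y) \<le> 1 / real m"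
proof -
  obtain k where k: "t + \<delta> \<le> x + of_int k" "x + of_int k \<le> t + 1 - \<delta>" using dS1_ge_imp_arc[OF assms(5)] .
  obtain l where l: "t + \<delta> \<le> y + of_int l" "y + of_int l \<le> t + 1 - \<delta>" using dS1_ge_imp_arc[OF assms(6)] .
  have "dS1 (F x) (F y) = dS1 (F (x + of_int k)) (F (y + of_int l))"
    by (intro dS1_cong circle_lift_circ_eq[OF F] circ_eq_sym[OF circ_eq_add_int])
  also have "\<dots> \<le> \<bar>F (x + of_int k) - F (y + of_int l)\<bar>" by (rule dS1_le_abs)
  also have "\<dots> \<le> 1 / real m" using circle_lift_gap[OF assms(1-4) k l] .
  finally show ?thesis .
qed

lemma circle_lift_id: "circle_lift id"
  unfolding circle_lift_def id_def[abs_def] using bij_id by (auto simp: id_def)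

context
  fixes F G :: "real \<Rightarrow> real"
  assumes F: "circle_lift F" and G: "circle_lift G"
begin

lemma DERIV_comp: "((F \<circ> G) has_real_derivative deriv F (G x) * deriv G x) (at x)"
  by (rule DERIV_chain[OF circle_lift_DERIV[OF F] circle_lift_DERIV[OF G]])

lemma deriv_comp: "deriv (F \<circ> G) x = deriv F (G x) * deriv G x"
  by (rule DERIV_imp_deriv[OF DERIV_comp])

lemma circle_lift_comp: "circle_lift (F \<circ> G)"
  unfolding circle_lift_def
proof (intro conjI allI)
  show "bij (F \<circ> G)" by (intro bij_comp circle_lift_bij F G)
  show "F \<circ> G differentiable at x" for x
    using DERIV_comp[of x] unfolding real_differentiable_def by blast
  show "continuous_on UNIV (deriv (F \<circ> G))"
    unfolding deriv_comp[abs_def]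
    by (intro continuous_intros circle_lift_deriv_continuous G
        continuous_on_compose2[OF circle_lift_deriv_continuous[OF F, of UNIV] circle_lift_continuous[OF G]]) auto
  show "deriv (F \<circ> G) x \<noteq> 0" for x
    by (simp add: deriv_comp circle_lift_deriv_nz F G)
  obtain s :: int where s: "s = 1 \<or> s = -1" "\<And>x l. F (x + of_int l) = F x + of_int (s * l)"
    by (rule circle_lift_degree[OF F]) metis
  obtain r :: int where r: "r = 1 \<or> r = -1" "\<And>x l. G (x + of_int l) = G x + of_int (r * l)"
    by (rule circle_lift_degree[OF G]) metis
  have "(F \<circ> G) (x + 1) = (F \<circ> G) x + of_int (s * r)" for x
    using r(2)[of x 1] s(2)[of "G x" r] by simp
  with s(1) r(1) show "(\<forall>x. (F \<circ> G) (x + 1) = (F \<circ> G) x + 1) \<or> (\<forall>x. (F \<circ> G) (x + 1) = (F \<circ> G) x - 1)"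
    by auto
qed

end

section \<open>Compositions along a sequence of lifts\<close>

lemma circle_lift_fwd:
  assumes "\<And>n. circle_lift (Y n)" shows "circle_lift (fwd Y n)"
  by (induction n) (simp_all only: fwd.simps circle_lift_id circle_lift_comp assms)

text \<open>This turns the convergence to \<open>\<theta>\<close> into a statement about preimages
  under the forward maps, as required by the gap argument.\<close>

lemma invbwd_eq_inv_fwd:
  assumes "\<And>n. circle_lift (Y n)" shows "invbwd Y n = inv (fwd Y n)"
proof (induction n)
  case (Suc n)
  then show ?case
    using o_inv_distrib[OF circle_lift_bij[OF assms] circle_lift_bij[OF circle_lift_fwd], of Y n n] assms
    by (simp only: fwd.simps invbwd.simps)
qed (simp only: fwd.simps invbwd.simps inv_id)

lemma ln_deriv_fwd:
  assumes "\<And>n. circle_lift (Y n)"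
  shows "ln \<bar>deriv (fwd Y n) x\<bar> = (\<Sum>j<n. ln \<bar>deriv (Y j) (fwd Y j x)\<bar>)"
proof (induction n)
  case 0
  then show ?case by (simp add: id_def)
next
  case (Suc n)
  then show ?case
    unfolding fwd.simps deriv_comp[OF assms circle_lift_fwd[OF assms]]
    by (simp add: abs_mult ln_mult circle_lift_deriv_nz circle_lift_fwd assms)
qed

lemma fwd_add: "fwd Y (k + n) = fwd (\<lambda>i. Y (i + k)) n \<circ> fwd Y k"
  by (induction n) (auto simp: add.commute comp_assoc)

lemma invfwd_eq_fwd: "invfwd \<omega> n = fwd (\<lambda>i. inv (\<omega> i)) n"
  by (induction n) auto

lemma invbwd_eq_bwd: "invbwd \<omega> n = bwd (\<lambda>i. inv (\<omega> i)) n"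
  by (induction n) auto

lemma borel_measurable_dS1 [measurable]:
  assumes [measurable]: "f \<in> borel_measurable M" "g \<in> borel_measurable M"
  shows "(\<lambda>x. dS1 (f x) (g x)) \<in> borel_measurable M"
  unfolding dS1_def frac_def by measurable

section \<open>Random compositions of circle diffeomorphisms\<close>

text \<open>Large \<open>k\<close> have error at most \<open>e * k\<close>, and the finitely many
  small \<open>k\<close> have bounded error. Uniformity in \<open>k \<le> n\<close> is needed
  because sums will be cut at a time that depends on the starting point.\<close>

lemma cesaro_uniform:
  fixes S :: "nat \<Rightarrow> real"
  assumes lim: "(\<lambda>n. S n / real n) \<longlonglongrightarrow> s" and S0: "S 0 = 0" and e: "e > 0"
  shows "\<forall>\<^sub>F n in sequentially. \<forall>k\<le>n. \<bar>S k - real k * s\<bar> \<le> e * real n"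
proof -
  from tendstoD[OF lim e] obtain K where K: "\<And>k. k \<ge> K \<Longrightarrow> \<bar>S k / real k - s\<bar> < e"
    unfolding eventually_sequentially dist_real_def by blast
  define C where "C = (\<Sum>k<K. \<bar>S k - real k * s\<bar>)"
  have C: "\<bar>S k - real k * s\<bar> \<le> C" if "k < K" for k
    unfolding C_def by (rule member_le_sum) (use that in auto)
  show ?thesis
  proof (rule eventually_sequentiallyI, safe)
    fix n k assume n: "n \<ge> nat \<lceil>C / e\<rceil>" and k: "k \<le> n"
    have "C \<le> e * real n" using n e by (simp add: field_simps)
    show "\<bar>S k - real k * s\<bar> \<le> e * real n"
    proof (cases "k < K")
      case True
      with C[OF this] \<open>C \<le> _\<close> show ?thesis by linarith
    next
      case False
      show ?thesis
      proof (cases "k = 0")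
        case True
        then show ?thesis using S0 e by simp
      next
        case k0: False
        have "S k - real k * s = real k * (S k / real k - s)"
          using k0 by (simp add: right_diff_distrib)
        then have "\<bar>S k - real k * s\<bar> = real k * \<bar>S k / real k - s\<bar>"
          by (simp only: abs_mult abs_of_nat)
        also have "\<dots> \<le> real k * e" using K[of k] False by (intro mult_left_mono) auto
        also have "\<dots> \<le> real n * e" using k e by (intro mult_right_mono) auto
        finally show ?thesis by (simp add: mult.commute)
      qed
    qed
  qed
qed

lemma circle_lift_dS1_tendsto:
  assumes F: "circle_lift F" and u: "(\<lambda>n. dS1 (u n) a) \<longlonglongrightarrow> 0"
  shows "(\<lambda>n. dS1 (F (u n)) (F a)) \<longlonglongrightarrow> 0"
proof -
  have "\<exists>l::int. dS1 (u n) a = \<bar>u n - a - of_int l\<bar>" for n by (metis dS1_attained)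
  then obtain l :: "nat \<Rightarrow> int" where l: "\<And>n. dS1 (u n) a = \<bar>u n - a - of_int (l n)\<bar>" by metis
  \<comment> \<open>Integer translates are chosen so that convergence on the circle becomes
    convergence on the line, where continuity of \<open>F\<close> applies.\<close>
  define v where "v n = u n + of_int (- l n)" for n
  have "(\<lambda>n. \<bar>v n - a\<bar>) \<longlonglongrightarrow> 0" using u unfolding l v_def by (simp add: algebra_simps)
  then have "v \<longlonglongrightarrow> a" by (simp add: tendsto_rabs_zero_iff LIM_zero_iff)
  then have "(\<lambda>n. F (v n)) \<longlonglongrightarrow> F a" by (rule isCont_tendsto_compose[OF circle_lift_isCont[OF F]])
  then have lim: "(\<lambda>n. \<bar>F (v n) - F a\<bar>) \<longlonglongrightarrow> 0" by (simp add: tendsto_rabs_zero_iff LIM_zero_iff)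
  have "dS1 (F (u n)) (F a) \<le> \<bar>F (v n) - F a\<bar>" for n
  proof -
    have "dS1 (F (u n)) (F a) = dS1 (F (v n)) (F a)"
      unfolding v_def by (rule dS1_cong[OF circle_lift_circ_eq[OF F circ_eq_sym[OF circ_eq_add_int]] circ_eq_refl])
    then show ?thesis using dS1_le_abs by simp
  qed
  then show ?thesis
    by (intro tendsto_sandwich[OF _ _ tendsto_const lim]) (auto simp: dS1_nonneg)
qed

text \<open>The indirection through \<open>act\<close> makes the inverse maps another instance over
  the same \<open>M\<close>, with \<open>\<pi>\<close> and \<open>\<theta>\<close> exchanged. The
  two moment conditions are merged into one integrable bound \<open>h\<close>, uniform in the point,
  and joint measurability allows evaluation at random points.\<close>

locale circle_cocycle = iid_sequences M for M :: "'a measure" +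
  fixes act :: "'a \<Rightarrow> real \<Rightarrow> real" and h :: "'a \<Rightarrow> real" and \<pi> \<theta> :: "(nat \<Rightarrow> 'a) \<Rightarrow> real"
  assumes lift: "f \<in> space M \<Longrightarrow> circle_lift (act f)"
    and act_measurable: "(\<lambda>p. act (fst p) (snd p)) \<in> borel_measurable (M \<Otimes>\<^sub>M borel)"
    and inv_act_measurable: "(\<lambda>p. inv (act (fst p)) (snd p)) \<in> borel_measurable (M \<Otimes>\<^sub>M borel)"
    and ln_deriv_measurable: "(\<lambda>p. ln \<bar>deriv (act (fst p)) (snd p)\<bar>) \<in> borel_measurable (M \<Otimes>\<^sub>M borel)"
    and h_integrable: "integrable M h"
    and h_bound: "f \<in> space M \<Longrightarrow> \<bar>ln \<bar>deriv (act f) x\<bar>\<bar> \<le> h f"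
    and \<pi>_measurable [measurable]: "\<pi> \<in> borel_measurable (PiM UNIV (\<lambda>_. M))"
    and \<theta>_measurable [measurable]: "\<theta> \<in> borel_measurable (PiM UNIV (\<lambda>_. M))"
    and \<pi>_lim: "\<And>x. AE \<omega> in PiM UNIV (\<lambda>_. M). (\<lambda>n. dS1 (bwd (\<lambda>i. act (\<omega> i)) n x) (\<pi> \<omega>)) \<longlonglongrightarrow> 0"
    and \<theta>_lim: "\<And>x. AE \<omega> in PiM UNIV (\<lambda>_. M). (\<lambda>n. dS1 (invbwd (\<lambda>i. act (\<omega> i)) n x) (\<theta> \<omega>)) \<longlonglongrightarrow> 0"
    and no_fixed_point: "\<not> (\<exists>p. AE f in M. circ_eq (act f p) p)"
begin

definition \<psi> :: "'a \<Rightarrow> real \<Rightarrow> real" where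
  "\<psi> f x = ln \<bar>deriv (act f) x\<bar>"

abbreviation Y :: "(nat \<Rightarrow> 'a) \<Rightarrow> nat \<Rightarrow> real \<Rightarrow> real" where
  "Y \<omega> \<equiv> \<lambda>i. act (\<omega> i)"

abbreviation tl_seq :: "nat \<Rightarrow> (nat \<Rightarrow> 'a) \<Rightarrow> nat \<Rightarrow> 'a" where
  "tl_seq k \<omega> \<equiv> \<lambda>i. \<omega> (i + k)"

lemma measurable_act [measurable]:
  assumes "f \<in> measurable N M" "g \<in> borel_measurable N"
  shows "(\<lambda>x. act (f x) (g x)) \<in> borel_measurable N"
  using measurable_compose[OF measurable_Pair[OF assms] act_measurable] by simp

lemma measurable_inv_act [measurable]:
  assumes "f \<in> measurable N M" "g \<in> borel_measurable N"
  shows "(\<lambda>x. inv (act (f x)) (g x)) \<in> borel_measurable N"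
  using measurable_compose[OF measurable_Pair[OF assms] inv_act_measurable] by simp

lemma measurable_\<psi> [measurable]:
  assumes "f \<in> measurable N M" "g \<in> borel_measurable N"
  shows "(\<lambda>x. \<psi> (f x) (g x)) \<in> borel_measurable N"
  using measurable_compose[OF measurable_Pair[OF assms] ln_deriv_measurable] by (simp add: \<psi>_def)

lemma measurable_h [measurable]: "h \<in> borel_measurable M"
  using h_integrable by auto

lemma measurable_invbwd [measurable]:
  assumes "g \<in> borel_measurable PM"
  shows "(\<lambda>\<omega>. invbwd (Y \<omega>) n (g \<omega>)) \<in> borel_measurable PM"
  using assms
proof (induction n arbitrary: g)
  case (Suc n)
  have "(\<lambda>\<omega>. inv (act (\<omega> n)) (g \<omega>)) \<in> borel_measurable PM" using Suc.prems by measurable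
  from Suc.IH[OF this] show ?case by (simp add: comp_def)
qed simp

lemma space_PM_D: "\<omega> \<in> space PM \<Longrightarrow> \<omega> i \<in> space M"
  by (auto simp: space_PiM)

lemma space_PM_tl: "\<omega> \<in> space PM \<Longrightarrow> tl_seq k \<omega> \<in> space PM"
  by (auto simp: space_PiM)

lemma Y_lift: "\<omega> \<in> space PM \<Longrightarrow> circle_lift (Y \<omega> n)"
  by (intro lift space_PM_D)

lemma Fn_lift: "\<omega> \<in> space PM \<Longrightarrow> circle_lift (fwd (Y \<omega>) n)"
  by (intro circle_lift_fwd Y_lift)

lemma \<psi>_bound: "f \<in> space M \<Longrightarrow> \<bar>\<psi> f x\<bar> \<le> h f"
  unfolding \<psi>_def by (rule h_bound)

lemma h_nonneg: "f \<in> space M \<Longrightarrow> 0 \<le> h f"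
  using \<psi>_bound[of f 0] by linarith

lemma \<psi>_periodic: "f \<in> space M \<Longrightarrow> \<psi> f (x + 1) = \<psi> f x"
  unfolding \<psi>_def by (simp add: circle_lift_deriv_periodic lift)

lemma \<psi>_circ_eq: "f \<in> space M \<Longrightarrow> circ_eq x y \<Longrightarrow> \<psi> f x = \<psi> f y"
  by (rule periodic_circ_eq[where g="\<psi> f"]) (auto simp: \<psi>_periodic)

lemma \<psi>_continuous: "f \<in> space M \<Longrightarrow> continuous_on A (\<psi> f)"
  unfolding \<psi>_def
  by (intro continuous_intros circle_lift_deriv_continuous lift) (auto simp: circle_lift_deriv_nz lift)

lemma ln_deriv_eq_sum: "\<omega> \<in> space PM \<Longrightarrow> ln \<bar>deriv (fwd (Y \<omega>) n) x\<bar> = (\<Sum>j<n. \<psi> (\<omega> j) (fwd (Y \<omega>) j x))"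
  unfolding \<psi>_def by (rule ln_deriv_fwd) (rule Y_lift)

text \<open>The supremum is restricted to rational points to make it measurable.\<close>

definition osc :: "nat \<Rightarrow> 'a \<Rightarrow> real" where
  "osc m f = (SUP p\<in>{p\<in>\<rat>\<times>\<rat>. \<bar>fst p - snd p\<bar> < 2 / real (Suc m)}. \<bar>\<psi> f (fst p) - \<psi> f (snd p)\<bar>)"

lemma osc_index_nonempty: "{p\<in>\<rat>\<times>\<rat>. \<bar>fst p - snd p\<bar> < 2 / real (Suc m)} \<noteq> {}"
  by (auto intro!: exI[of _ "0::real"])

lemma \<psi>_diff_bound: "f \<in> space M \<Longrightarrow> \<bar>\<psi> f x - \<psi> f y\<bar> \<le> 2 * h f"
  using \<psi>_bound[of f x] \<psi>_bound[of f y] by linarith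

lemma osc_bdd: "f \<in> space M \<Longrightarrow> bdd_above ((\<lambda>p. \<bar>\<psi> f (fst p) - \<psi> f (snd p)\<bar>) ` A)"
  using \<psi>_diff_bound by (intro bdd_aboveI[of _ "2 * h f"]) auto

lemma osc_le: "f \<in> space M \<Longrightarrow> osc m f \<le> 2 * h f"
  unfolding osc_def by (intro cSUP_least osc_index_nonempty \<psi>_diff_bound)

lemma osc_nonneg: "f \<in> space M \<Longrightarrow> 0 \<le> osc m f"
  unfolding osc_def
  by (rule cSUP_upper2[OF osc_bdd, where x="(0,0)"]) auto

lemma measurable_osc [measurable]: "osc m \<in> borel_measurable M"
  unfolding osc_def[abs_def]
proof (rule borel_measurable_cSUP)
  show "countable {p \<in> \<rat> \<times> \<rat>. \<bar>fst p - snd p\<bar> < 2 / real (Suc m)}"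
    by (rule countable_subset[of _ "\<rat> \<times> \<rat>"]) (auto intro: countable_rat)
qed (auto intro: osc_bdd)

lemma integrable_osc: "integrable M (osc m)"
  by (rule Bochner_Integration.integrable_bound[of _ "\<lambda>f. 2 * h f"])
     (use h_integrable in \<open>auto simp: osc_nonneg h_nonneg osc_le intro!: AE_I2\<close>)

text \<open>Rational approximations of a pair at distance at most \<open>1 / (m + 1)\<close> need
  not stay within that distance, but they eventually stay below the doubled scale used in
  \<open>osc\<close>; continuity carries the bound to the limit.\<close>

lemma \<psi>_diff_le_osc:
  assumes f: "f \<in> space M" and xy: "dS1 x y \<le> 1 / real (Suc m)"
  shows "\<bar>\<psi> f x - \<psi> f y\<bar> \<le> osc m f"
proof -
  obtain l :: int where l: "dS1 x y = \<bar>x - y - of_int l\<bar>" by (rule dS1_attained)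
  define y' where "y' = y + of_int l"
  have y': "\<psi> f y' = \<psi> f y" unfolding y'_def by (rule \<psi>_circ_eq[OF f circ_eq_add_int])
  have "\<bar>x - y'\<bar> \<le> 1 / real (Suc m)" using xy l unfolding y'_def by (simp add: algebra_simps)
  also have "\<dots> < 2 / real (Suc m)" by (simp add: divide_strict_right_mono)
  finally have lt: "\<bar>x - y'\<bar> < 2 / real (Suc m)" .
  have "\<exists>u. (\<forall>n::nat. u n \<in> \<rat>) \<and> u \<longlonglongrightarrow> x" for x :: real
    using closure_sequential[of x \<rat>] by (simp add: Rats_closure_real)
  then obtain u v where u: "\<And>n::nat. u n \<in> \<rat>" "u \<longlonglongrightarrow> x" and v: "\<And>n::nat. v n \<in> \<rat>" "v \<longlonglongrightarrow> y'"
    by metis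
  have cont: "isCont (\<psi> f) t" for t
    using \<psi>_continuous[OF f, of UNIV] by (simp add: continuous_on_eq_continuous_at)
  have lim: "(\<lambda>n. \<bar>\<psi> f (u n) - \<psi> f (v n)\<bar>) \<longlonglongrightarrow> \<bar>\<psi> f x - \<psi> f y'\<bar>"
    using u v by (intro tendsto_intros isCont_tendsto_compose[OF cont])
  have "(\<lambda>n. \<bar>u n - v n\<bar>) \<longlonglongrightarrow> \<bar>x - y'\<bar>" using u v by (intro tendsto_intros)
  from order_tendstoD(2)[OF this lt]
  have "\<forall>\<^sub>F n in sequentially. \<bar>\<psi> f (u n) - \<psi> f (v n)\<bar> \<le> osc m f"
  proof eventually_elim
    case (elim n)
    then show ?case
      unfolding osc_def by (intro cSUP_upper2[OF osc_bdd[OF f], where x="(u n, v n)"]) (auto simp: u v)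
  qed
  from tendsto_upperbound[OF lim this] show ?thesis using y' by simp
qed

lemma osc_tendsto: assumes f: "f \<in> space M" shows "(\<lambda>m. osc m f) \<longlonglongrightarrow> 0"
proof (rule tendstoI)
  fix e :: real assume e: "e > 0"
  obtain d where d: "d > 0" "\<And>x y. \<bar>x - y\<bar> < d \<Longrightarrow> \<bar>\<psi> f x - \<psi> f y\<bar> < e / 2"
    using periodic_uniformly_continuous[of "\<psi> f" "e/2"] \<psi>_periodic[OF f] \<psi>_continuous[OF f] e by auto
  have "(\<lambda>m. 2 / real (Suc m)) \<longlonglongrightarrow> 0" by (rule LIMSEQ_Suc[OF lim_const_over_n])
  from order_tendstoD(2)[OF this d(1)]
  show "\<forall>\<^sub>F m in sequentially. dist (osc m f) 0 < e"
  proof eventually_elim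
    case (elim m)
    have "osc m f \<le> e / 2"
      unfolding osc_def using elim by (intro cSUP_least osc_index_nonempty less_imp_le d(2)) auto
    with osc_nonneg[OF f, of m] e show ?case by simp
  qed
qed

text \<open>The averaged modulus of continuity vanishes by dominated convergence with majorant
  \<open>2 * h\<close>, although no modulus is uniform over the maps.\<close>

lemma osc_mean_tendsto: "(\<lambda>m. \<integral>f. osc m f \<partial>M) \<longlonglongrightarrow> 0"
proof -
  have "(\<lambda>m. \<integral>f. osc m f \<partial>M) \<longlonglongrightarrow> (\<integral>f. 0 \<partial>M)"
    by (rule integral_dominated_convergence[where w="\<lambda>f. 2 * h f"])
       (use h_integrable in \<open>auto simp: osc_nonneg osc_le osc_tendsto intro!: AE_I2\<close>)
  then show ?thesis by simp
qed

end

section \<open>Deterministic estimates along one regular sequence\<close>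

lemma sum_split_at:
  fixes a b :: "nat \<Rightarrow> real"
  assumes "k \<le> n"
  shows "(\<Sum>j<n. if j < k then a j else b j) = (\<Sum>j<k. a j) + (\<Sum>j<n. b j) - (\<Sum>j<k. b j)"
  using assms by (induction n rule: dec_induct) auto

lemma sum_window:
  fixes b :: "nat \<Rightarrow> real"
  assumes "k \<le> p" "p \<le> n"
  shows "(\<Sum>j<n. if k \<le> j \<and> j < p then b j else 0) = (\<Sum>j<p. b j) - (\<Sum>j<k. b j)"
proof -
  have "(\<Sum>j<n. if k \<le> j \<and> j < p then b j else 0) = (\<Sum>j<n. if j < p then (if j < k then 0 else b j) else 0)"
    by (intro sum.cong) auto
  also have "\<dots> = (\<Sum>j<p. if j < k then 0 else b j)"
    using sum_split_at[OF assms(2), of "\<lambda>j. if j < k then 0 else b j" "\<lambda>_. 0"] by simp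
  also have "\<dots> = (\<Sum>j<p. b j) - (\<Sum>j<k. b j)"
    using sum_split_at[OF assms(1), of "\<lambda>_. 0" b] by simp
  finally show ?thesis .
qed

lemma eventually_const_le_linear:
  fixes C e :: real
  assumes "e > 0"
  shows "\<forall>\<^sub>F n in sequentially. C \<le> e * real n"
proof (rule eventually_sequentiallyI)
  fix n assume "n \<ge> nat \<lceil>C / e\<rceil>"
  then have "C / e \<le> real n" by linarith
  then show "C \<le> e * real n" using assms by (simp add: field_simps)
qed

context circle_cocycle
begin

text \<open>If \<open>\<omega>\<close> is not bad for \<open>z\<close>, then after \<open>N\<close> steps the orbit of \<open>z\<close> attracts all points outside
  the \<open>1 / (m + 1)\<close>-ball around \<open>\<theta> \<omega>\<close>: the backward images of the grid points \<open>i / (m + 1)\<close> all lie in that ball,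
  so the complement of the ball is mapped into a single gap of the grid.\<close>

definition bad :: "nat \<Rightarrow> nat \<Rightarrow> real \<Rightarrow> (nat \<Rightarrow> 'a) \<Rightarrow> bool" where
  "bad m N z \<omega> \<longleftrightarrow> dS1 z (\<theta> \<omega>) \<le> 1 / real (Suc m) \<or>
     (\<exists>k\<ge>N. \<exists>i<Suc m. 1 / real (Suc m) \<le> dS1 (invbwd (Y \<omega>) k (real i / real (Suc m))) (\<theta> \<omega>))"

definition osc_mean :: "nat \<Rightarrow> real" where
  "osc_mean m = (\<integral>f. osc m f \<partial>M)"

text \<open>The weight \<open>h\<close> is essential: a bad time can cost \<open>2 * h\<close> in a
  Birkhoff sum, and \<open>h\<close> is not bounded, so a small frequency of bad times alone would
  not control the error.\<close>

definition bad_mean :: "nat \<Rightarrow> nat \<Rightarrow> real" where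
  "bad_mean m N = (\<integral>w. of_bool (bad m N (\<pi> (past w)) (future w)) * h (w 0) \<partial>WM)"

text \<open>\<open>\<pi> (past w)\<close> is a stationary initial point independent of \<open>future w\<close>, and \<open>\<theta> (future w)\<close> is
  the repelling point.\<close>

definition min_exp :: real where
  "min_exp = (\<integral>w. \<psi> (w 0) (\<pi> (past w)) \<partial>WM)"

definition max_exp :: real where
  "max_exp = (\<integral>w. \<psi> (w 0) (\<theta> (future w)) \<partial>WM)"

text \<open>Every almost sure property used by the deterministic estimates is collected here.
  Convergence is asked at rational points only, which are countably many and include all grid
  points.\<close>

definition regular :: "real \<Rightarrow> (nat \<Rightarrow> 'a) \<Rightarrow> bool" where
  "regular z \<omega> \<longleftrightarrow> \<omega> \<in> space PM \<and> \<not> circ_eq z (\<theta> \<omega>)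
    \<and> (\<forall>q\<in>\<rat>. (\<lambda>n. dS1 (invbwd (Y \<omega>) n q) (\<theta> \<omega>)) \<longlonglongrightarrow> 0)
    \<and> (\<forall>j. circ_eq (fwd (Y \<omega>) j (\<theta> \<omega>)) (\<theta> (tl_seq j \<omega>)))
    \<and> (\<forall>m. (\<lambda>n. (\<Sum>j<n. osc m (\<omega> j)) / real n) \<longlonglongrightarrow> osc_mean m)
    \<and> (\<lambda>n. (\<Sum>j<n. h (\<omega> j)) / real n) \<longlonglongrightarrow> (\<integral>f. h f \<partial>M)
    \<and> (\<lambda>n. (\<Sum>j<n. \<psi> (\<omega> j) (fwd (Y \<omega>) j z)) / real n) \<longlonglongrightarrow> min_exp
    \<and> (\<lambda>n. (\<Sum>j<n. \<psi> (\<omega> j) (fwd (Y \<omega>) j (\<theta> \<omega>))) / real n) \<longlonglongrightarrow> max_exp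
    \<and> (\<forall>m N. (\<lambda>n. (\<Sum>j<n. of_bool (bad m N (fwd (Y \<omega>) j z) (tl_seq j \<omega>)) * h (\<omega> j)) / real n) \<longlonglongrightarrow> bad_mean m N)"

lemma not_bad_contracts:
  assumes "\<omega> \<in> space PM" "\<not> bad m N z \<omega>" "1 / real (Suc m) < dS1 x (\<theta> \<omega>)" "N \<le> k"
  shows "dS1 (fwd (Y \<omega>) k x) (fwd (Y \<omega>) k z) \<le> 1 / real (Suc m)"
proof (rule circle_lift_gap_dS1[OF Fn_lift[OF assms(1)], where t="\<theta> \<omega>" and \<delta>="1 / real (Suc m)"])
  fix i assume i: "i < Suc m"
  have "invbwd (Y \<omega>) k = inv (fwd (Y \<omega>) k)" by (rule invbwd_eq_inv_fwd) (rule Y_lift[OF assms(1)])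
  then show "dS1 (inv (fwd (Y \<omega>) k) (real i / real (Suc m))) (\<theta> \<omega>) < 1 / real (Suc m)"
    using assms(2,4) i unfolding bad_def by (metis not_le)
qed (use assms(2,3) in \<open>auto simp: bad_def not_le\<close>)

lemma regular_near:
  assumes reg: "regular z \<omega>" and \<delta>: "\<delta> > 0"
  shows "\<forall>\<^sub>F n in sequentially. \<forall>i<m. dS1 (inv (fwd (Y \<omega>) n) (real i / real m)) (\<theta> \<omega>) < \<delta>"
proof -
  have \<omega>: "\<omega> \<in> space PM" using reg by (simp add: regular_def)
  have "\<forall>\<^sub>F n in sequentially. dS1 (invbwd (Y \<omega>) n (real i / real m)) (\<theta> \<omega>) < \<delta>" for i
    using reg \<delta> unfolding regular_def by (intro order_tendstoD) auto
  then have "\<forall>\<^sub>F n in sequentially. \<forall>i\<in>{..<m}. dS1 (invbwd (Y \<omega>) n (real i / real m)) (\<theta> \<omega>) < \<delta>"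
    by (intro eventually_ball_finite) auto
  moreover have "invbwd (Y \<omega>) n = inv (fwd (Y \<omega>) n)" for n
    by (rule invbwd_eq_inv_fwd) (rule Y_lift[OF \<omega>])
  ultimately show ?thesis by (auto elim!: eventually_mono)
qed

text \<open>From some time on, all points away from \<open>\<theta> \<omega>\<close> follow the
  orbit of \<open>z\<close> within \<open>1 / (m + 1)\<close>, at a time independent of
  \<open>x\<close>. The budget \<open>e\<close> is spent in quarters: the mean of
  \<open>osc\<close>, its fluctuation, the first \<open>K\<close> steps, and the fluctuation along
  \<open>z\<close>.\<close>

lemma regular_uniform_away:
  assumes reg: "regular z \<omega>" and \<delta>: "\<delta> > 0" and e: "e > 0"
  shows "\<forall>\<^sub>F n in sequentially. \<forall>x. \<delta> \<le> dS1 x (\<theta> \<omega>) \<longrightarrow>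
           \<bar>ln \<bar>deriv (fwd (Y \<omega>) n) x\<bar> - real n * min_exp\<bar> \<le> e * real n"
proof -
  have \<omega>: "\<omega> \<in> space PM" and z: "\<not> circ_eq z (\<theta> \<omega>)" using reg by (auto simp: regular_def)
  have \<omega>M: "\<omega> j \<in> space M" for j using \<omega> by (rule space_PM_D)
  let ?F = "fwd (Y \<omega>)"
  have e4: "e / 4 > 0" using e by simp
  obtain m where m: "osc_mean m < e / 4"
    using order_tendstoD(2)[OF osc_mean_tendsto e4] unfolding osc_mean_def[symmetric] eventually_sequentially by blast
  \<comment> \<open>The radius is shrunk so that \<open>z\<close> itself lies in the arc that is
    contracted.\<close>
  define \<delta>' where "\<delta>' = min \<delta> (dS1 z (\<theta> \<omega>))"
  have "dS1 z (\<theta> \<omega>) \<noteq> 0" using z by (simp add: dS1_eq_0_iff)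
  then have \<delta>': "\<delta>' > 0" unfolding \<delta>'_def using \<delta> dS1_nonneg[of z "\<theta> \<omega>"] by simp
  obtain K where K: "\<And>n i. n \<ge> K \<Longrightarrow> i < Suc m \<Longrightarrow> dS1 (inv (?F n) (real i / real (Suc m))) (\<theta> \<omega>) < \<delta>'"
    using regular_near[OF reg \<delta>', of "Suc m"] unfolding eventually_sequentially by blast
  have oscl: "(\<lambda>n. (\<Sum>j<n. osc m (\<omega> j)) / real n) \<longlonglongrightarrow> osc_mean m"
    and zl: "(\<lambda>n. (\<Sum>j<n. \<psi> (\<omega> j) (?F j z)) / real n) \<longlonglongrightarrow> min_exp"
    using reg unfolding regular_def by blast+
  have ev1: "\<forall>\<^sub>F n in sequentially. \<forall>k\<le>n. \<bar>(\<Sum>j<k. osc m (\<omega> j)) - real k * osc_mean m\<bar> \<le> e / 4 * real n"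
    by (rule cesaro_uniform[OF oscl _ e4]) simp
  have ev2: "\<forall>\<^sub>F n in sequentially. \<forall>k\<le>n. \<bar>(\<Sum>j<k. \<psi> (\<omega> j) (?F j z)) - real k * min_exp\<bar> \<le> e / 4 * real n"
    by (rule cesaro_uniform[OF zl _ e4]) simp
  have ev3: "\<forall>\<^sub>F n in sequentially. (\<Sum>j<K. 2 * h (\<omega> j)) \<le> e / 4 * real n"
    by (rule eventually_const_le_linear[OF e4])
  show ?thesis
    using ev1 ev2 ev3 eventually_ge_at_top[of K]
  proof eventually_elim
    case (elim n)
    show ?case
    proof (intro allI impI)
      fix x assume x: "\<delta> \<le> dS1 x (\<theta> \<omega>)"
      let ?r = "\<lambda>j. osc m (\<omega> j) + (if j < K then 2 * h (\<omega> j) else 0)"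
      have step: "\<bar>\<psi> (\<omega> j) (?F j x) - \<psi> (\<omega> j) (?F j z)\<bar> \<le> ?r j" for j
      proof (cases "j < K")
        case True
        then show ?thesis
          using \<psi>_diff_bound[OF \<omega>M[of j], of "?F j x" "?F j z"] osc_nonneg[OF \<omega>M, of m j] by simp
      next
        case False
        have "dS1 (?F j x) (?F j z) \<le> 1 / real (Suc m)"
          by (rule circle_lift_gap_dS1[OF Fn_lift[OF \<omega>] _ \<delta>', where t="\<theta> \<omega>"])
             (use K False x in \<open>auto simp: \<delta>'_def\<close>)
        from \<psi>_diff_le_osc[OF \<omega>M this, of j] False show ?thesis by simp
      qed
      have "\<bar>(\<Sum>j<n. \<psi> (\<omega> j) (?F j x)) - (\<Sum>j<n. \<psi> (\<omega> j) (?F j z))\<bar> \<le> (\<Sum>j<n. ?r j)"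
        unfolding sum_subtractf[symmetric] by (rule order.trans[OF sum_abs sum_mono]) (rule step)
      also have "\<dots> = (\<Sum>j<n. osc m (\<omega> j)) + (\<Sum>j<K. 2 * h (\<omega> j))"
        using sum_split_at[OF elim(4), of "\<lambda>j. 2 * h (\<omega> j)" "\<lambda>_. 0"] by (simp add: sum.distrib)
      also have "(\<Sum>j<n. osc m (\<omega> j)) \<le> real n * osc_mean m + e / 4 * real n"
        using elim(1)[rule_format, OF order_refl] by linarith
      also have "real n * osc_mean m \<le> e / 4 * real n"
        using mult_left_mono[of "osc_mean m" "e/4" "real n"] m by (simp add: mult.commute)
      finally have "\<bar>(\<Sum>j<n. \<psi> (\<omega> j) (?F j x)) - (\<Sum>j<n. \<psi> (\<omega> j) (?F j z))\<bar> \<le> 3 * (e / 4 * real n)"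
        using elim(3) by linarith
      with elim(2)[rule_format, OF order_refl]
      show "\<bar>ln \<bar>deriv (?F n) x\<bar> - real n * min_exp\<bar> \<le> e * real n"
        unfolding ln_deriv_eq_sum[OF \<omega>] by linarith
    qed
  qed
qed

text \<open>A positive exponent would make the derivative exceed 2 on the arc of length 1/2 opposite
  to \<open>\<theta> \<omega>\<close>, so its image would be longer than 1; the gap lemma with the
  one-point grid \<open>{0}\<close> bounds it by 1.\<close>

lemma min_exp_nonpos:
  assumes reg: "regular z \<omega>"
  shows "min_exp \<le> 0"
proof (rule ccontr)
  assume "\<not> ?thesis"
  then have c: "min_exp / 2 > 0" by simp
  have \<omega>: "\<omega> \<in> space PM" using reg by (auto simp: regular_def)
  let ?F = "fwd (Y \<omega>)"
  let ?a = "\<theta> \<omega> + 1/4" and ?b = "\<theta> \<omega> + 3/4"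
  have "\<forall>\<^sub>F n in sequentially. \<forall>x. 1/4 \<le> dS1 x (\<theta> \<omega>) \<longrightarrow>
           \<bar>ln \<bar>deriv (?F n) x\<bar> - real n * min_exp\<bar> \<le> min_exp / 2 * real n"
    by (rule regular_uniform_away[OF reg _ c]) simp
  moreover have "\<forall>\<^sub>F n in sequentially. \<forall>i<1. dS1 (inv (?F n) (real i / real 1)) (\<theta> \<omega>) < 1/4"
    by (rule regular_near[OF reg]) simp
  moreover have "\<forall>\<^sub>F n in sequentially. 2 \<le> min_exp / 2 * real n"
    by (rule eventually_const_le_linear[OF c])
  ultimately have "\<forall>\<^sub>F n in sequentially. False"
  proof eventually_elim
    case (elim n)
    obtain x where x: "?a < x" "x < ?b" "?F n ?b - ?F n ?a = (?b - ?a) * deriv (?F n) x"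
      by (rule circle_lift_mvt[OF Fn_lift[OF \<omega>, of n], of ?a ?b]) auto
    have "1/4 \<le> dS1 x (\<theta> \<omega>)" using x by (intro arc_imp_dS1_ge) auto
    with elim(1) have "\<bar>ln \<bar>deriv (?F n) x\<bar> - real n * min_exp\<bar> \<le> min_exp / 2 * real n" by blast
    moreover have "real n * min_exp = 2 * (min_exp / 2 * real n)" by simp
    ultimately have "2 \<le> ln \<bar>deriv (?F n) x\<bar>" using elim(3) by linarith
    moreover have "\<bar>deriv (?F n) x\<bar> > 0"
      using circle_lift_deriv_nz[OF Fn_lift[OF \<omega>], of n x] by simp
    ultimately have "2 < \<bar>deriv (?F n) x\<bar>"
      using ln_less_self[of "\<bar>deriv (?F n) x\<bar>"] by linarith
    moreover have "\<bar>?F n ?b - ?F n ?a\<bar> \<le> 1 / real 1"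
      by (rule circle_lift_gap[OF Fn_lift[OF \<omega>], where t="\<theta> \<omega>" and \<delta>="1/4"]) (use elim(2) in auto)
    ultimately show False using x(3) by (simp add: abs_mult)
  qed
  then show False by simp
qed

text \<open>An orbit stays close to the orbit of \<open>\<theta> \<omega>\<close> up to the first good time \<open>k\<close> at which it is away
  from it, and from time \<open>k + N\<close> on it follows the orbit of \<open>z\<close>; bad times are rare.\<close>

lemma regular_sandwich:
  assumes reg: "regular z \<omega>" and e: "e > 0"
    and small: "\<And>e. e > 0 \<Longrightarrow> \<exists>m N. osc_mean m < e \<and> bad_mean m N < e"
  shows "\<forall>\<^sub>F n in sequentially. \<forall>x. \<exists>k\<le>n.
           \<bar>ln \<bar>deriv (fwd (Y \<omega>) n) x\<bar> - (real k * max_exp + real (n - k) * min_exp)\<bar> \<le> e * real n"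
proof -
  have \<omega>: "\<omega> \<in> space PM" using reg by (auto simp: regular_def)
  have \<omega>M: "\<omega> j \<in> space M" for j using \<omega> by (rule space_PM_D)
  let ?F = "fwd (Y \<omega>)"
  \<comment> \<open>Comparison with the reference orbit costs 12 units \<open>d * n\<close>: 2 for
    \<open>osc\<close>, 2 times 2 for bad times, 2 times 3 for the window of length at most
    \<open>N\<close>. The averages along the reference orbit cost 3 more.\<close>
  define d where "d = e / 15"
  have d: "d > 0" using e by (simp add: d_def)
  obtain m N where mN: "osc_mean m < d" "bad_mean m N < d" using small[OF d] by blast
  define b where "b j = of_bool (bad m N (?F j z) (tl_seq j \<omega>)) * h (\<omega> j)" for j
  let ?\<eta> = "\<integral>f. h f \<partial>M"
  have oscl: "(\<lambda>n. (\<Sum>j<n. osc m (\<omega> j)) / real n) \<longlonglongrightarrow> osc_mean m"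
    and hl: "(\<lambda>n. (\<Sum>j<n. h (\<omega> j)) / real n) \<longlonglongrightarrow> ?\<eta>"
    and zl: "(\<lambda>n. (\<Sum>j<n. \<psi> (\<omega> j) (?F j z)) / real n) \<longlonglongrightarrow> min_exp"
    and tl: "(\<lambda>n. (\<Sum>j<n. \<psi> (\<omega> j) (?F j (\<theta> \<omega>))) / real n) \<longlonglongrightarrow> max_exp"
    and bl: "(\<lambda>n. (\<Sum>j<n. b j) / real n) \<longlonglongrightarrow> bad_mean m N"
    and equi: "\<And>j. circ_eq (?F j (\<theta> \<omega>)) (\<theta> (tl_seq j \<omega>))"
    using reg unfolding regular_def b_def by blast+
  have ev1: "\<forall>\<^sub>F n in sequentially. \<forall>k\<le>n. \<bar>(\<Sum>j<k. osc m (\<omega> j)) - real k * osc_mean m\<bar> \<le> d * real n"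
    by (rule cesaro_uniform[OF oscl _ d]) simp
  have ev2: "\<forall>\<^sub>F n in sequentially. \<forall>k\<le>n. \<bar>(\<Sum>j<k. \<psi> (\<omega> j) (?F j z)) - real k * min_exp\<bar> \<le> d * real n"
    by (rule cesaro_uniform[OF zl _ d]) simp
  have ev3: "\<forall>\<^sub>F n in sequentially. \<forall>k\<le>n. \<bar>(\<Sum>j<k. \<psi> (\<omega> j) (?F j (\<theta> \<omega>))) - real k * max_exp\<bar> \<le> d * real n"
    by (rule cesaro_uniform[OF tl _ d]) simp
  have ev4: "\<forall>\<^sub>F n in sequentially. \<forall>k\<le>n. \<bar>(\<Sum>j<k. b j) - real k * bad_mean m N\<bar> \<le> d * real n"
    by (rule cesaro_uniform[OF bl _ d]) simp
  have ev5: "\<forall>\<^sub>F n in sequentially. \<forall>k\<le>n. \<bar>(\<Sum>j<k. h (\<omega> j)) - real k * ?\<eta>\<bar> \<le> d * real n"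
    by (rule cesaro_uniform[OF hl _ d]) simp
  have ev6: "\<forall>\<^sub>F n in sequentially. real N * \<bar>?\<eta>\<bar> \<le> d * real n"
    by (rule eventually_const_le_linear[OF d])
  show ?thesis
    using ev1 ev2 ev3 ev4 ev5 ev6
  proof eventually_elim
    case (elim n)
    show ?case
    proof
      fix x
      define good where "good j \<longleftrightarrow> \<not> bad m N (?F j z) (tl_seq j \<omega>) \<and> 1 / real (Suc m) < dS1 (?F j x) (\<theta> (tl_seq j \<omega>))" for j
      \<comment> \<open>The default \<open>n\<close> covers orbits without a good time before
        \<open>n\<close>: they are compared with the orbit of \<open>\<theta> \<omega>\<close>
        throughout.\<close>
      define k where "k = (if \<exists>j<n. good j then LEAST j. good j else n)"
      have k: "k \<le> n" "\<And>j. j < k \<Longrightarrow> \<not> good j" "k < n \<Longrightarrow> good k"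
      proof -
        show "k \<le> n" unfolding k_def by (auto intro: Least_le order.trans less_imp_le)
        show "\<not> good j" if "j < k" for j using that not_less_Least unfolding k_def by (auto split: if_splits)
        show "good k" if "k < n" using that LeastI unfolding k_def by (auto split: if_splits)
      qed
      \<comment> \<open>Between \<open>k\<close> and \<open>p\<close> contraction is not yet
        guaranteed; these at most \<open>N\<close> steps are paid with \<open>2 * h\<close>
        each.\<close>
      define p where "p = min n (k + N)"
      have p: "k \<le> p" "p \<le> n" using k(1) by (auto simp: p_def)
      let ?ref = "\<lambda>j. if j < k then \<psi> (\<omega> j) (?F j (\<theta> \<omega>)) else \<psi> (\<omega> j) (?F j z)"
      let ?r = "\<lambda>j. osc m (\<omega> j) + 2 * b j + 2 * (if k \<le> j \<and> j < p then h (\<omega> j) else 0)"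
      have step: "\<bar>\<psi> (\<omega> j) (?F j x) - ?ref j\<bar> \<le> ?r j" if j: "j < n" for j
      proof -
        have nn: "0 \<le> osc m (\<omega> j)" "0 \<le> h (\<omega> j)" by (intro osc_nonneg h_nonneg \<omega>M)+
        then have nb: "0 \<le> b j" by (simp add: b_def)
        \<comment> \<open>Before \<open>k\<close> a time is bad, or else failure of
          \<open>good\<close> forces closeness to the repelling orbit. From \<open>k + N\<close> on,
          goodness of \<open>k\<close> gives contraction towards the orbit of
          \<open>z\<close>.\<close>
        consider "j < k" "bad m N (?F j z) (tl_seq j \<omega>)" | "j < k" "\<not> bad m N (?F j z) (tl_seq j \<omega>)"
          | "k \<le> j" "j < p" | "p \<le> j" "k \<le> j" using k(1) p by linarith
        then show ?thesis
        proof cases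
          case 1
          then show ?thesis using \<psi>_diff_bound[OF \<omega>M[of j], of "?F j x" "?F j (\<theta> \<omega>)"] nn by (simp add: b_def)
        next
          case 2
          then have "dS1 (?F j x) (\<theta> (tl_seq j \<omega>)) \<le> 1 / real (Suc m)"
            using k(2)[of j] unfolding good_def by auto
          then have "dS1 (?F j x) (?F j (\<theta> \<omega>)) \<le> 1 / real (Suc m)"
            using dS1_cong[OF circ_eq_refl equi, of "?F j x" j] by simp
          from \<psi>_diff_le_osc[OF \<omega>M this, of j] 2 show ?thesis by (simp add: b_def)
        next
          case 3
          then show ?thesis using \<psi>_diff_bound[OF \<omega>M[of j], of "?F j x" "?F j z"] nn nb by simp
        next
          case 4
          with j have kn: "k < n" "k + N \<le> j" by (auto simp: p_def)
          define i where "i = j - k"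
          have ji: "j = k + i" "N \<le> i" using kn by (auto simp: i_def)
          have "good k" using k(3) kn by blast
          then have "dS1 (fwd (Y (tl_seq k \<omega>)) i (?F k x)) (fwd (Y (tl_seq k \<omega>)) i (?F k z)) \<le> 1 / real (Suc m)"
            unfolding good_def using ji by (intro not_bad_contracts[where N=N] space_PM_tl \<omega>) auto
          then have "dS1 (?F j x) (?F j z) \<le> 1 / real (Suc m)"
            unfolding ji fwd_add by simp
          from \<psi>_diff_le_osc[OF \<omega>M this, of j] 4 nn nb show ?thesis by simp
        qed
      qed
      have "\<bar>(\<Sum>j<n. \<psi> (\<omega> j) (?F j x)) - (\<Sum>j<n. ?ref j)\<bar> \<le> (\<Sum>j<n. ?r j)"
        unfolding sum_subtractf[symmetric] by (rule order.trans[OF sum_abs sum_mono]) (rule step, simp)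
      also have "\<dots> = (\<Sum>j<n. osc m (\<omega> j)) + 2 * (\<Sum>j<n. b j) + 2 * ((\<Sum>j<p. h (\<omega> j)) - (\<Sum>j<k. h (\<omega> j)))"
        unfolding sum_window[OF p, symmetric] by (simp add: sum.distrib sum_distrib_left)
      also have "(\<Sum>j<n. osc m (\<omega> j)) \<le> 2 * (d * real n)"
      proof -
        have "real n * osc_mean m \<le> real n * d" using mN by (intro mult_left_mono) auto
        then show ?thesis using elim(1)[rule_format, OF order_refl] by (simp add: mult.commute abs_le_iff)
      qed
      also have "(\<Sum>j<n. b j) \<le> 2 * (d * real n)"
      proof -
        have "real n * bad_mean m N \<le> real n * d" using mN by (intro mult_left_mono) auto
        then show ?thesis using elim(4)[rule_format, OF order_refl] by (simp add: mult.commute abs_le_iff)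
      qed
      also have "(\<Sum>j<p. h (\<omega> j)) - (\<Sum>j<k. h (\<omega> j)) \<le> 3 * (d * real n)"
      proof -
        have "(real p - real k) * ?\<eta> \<le> real N * \<bar>?\<eta>\<bar>"
          using p by (intro order.trans[OF mult_left_mono[OF abs_ge_self] mult_right_mono]) (auto simp: p_def)
        then show ?thesis
          using elim(5)[rule_format, OF p(2)] elim(5)[rule_format, OF k(1)] elim(6) unfolding left_diff_distrib by linarith
      qed
      finally have *: "\<bar>(\<Sum>j<n. \<psi> (\<omega> j) (?F j x)) - (\<Sum>j<n. ?ref j)\<bar> \<le> 12 * (d * real n)" by simp
      \<comment> \<open>The part along \<open>z\<close> is a difference of sums up to
        \<open>n\<close> and up to \<open>k\<close>, which together with the part along
        \<open>\<theta> \<omega>\<close> gives three fluctuations.\<close>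
      have "\<bar>(\<Sum>j<n. ?ref j) - (real k * max_exp + real (n - k) * min_exp)\<bar> \<le> 3 * (d * real n)"
        unfolding sum_split_at[OF k(1)]
        using elim(2)[rule_format, OF order_refl] elim(2)[rule_format, OF k(1)] elim(3)[rule_format, OF k(1)]
        unfolding of_nat_diff[OF k(1)] left_diff_distrib by linarith
      with * have "\<bar>ln \<bar>deriv (?F n) x\<bar> - (real k * max_exp + real (n - k) * min_exp)\<bar> \<le> e * real n"
        unfolding ln_deriv_eq_sum[OF \<omega>] d_def by (simp, linarith?)
      with k(1) show "\<exists>k\<le>n. \<bar>ln \<bar>deriv (?F n) x\<bar> - (real k * max_exp + real (n - k) * min_exp)\<bar> \<le> e * real n"
        by blast
    qed
  qed
qed

text \<open>As \<open>min_exp \<le> 0 \<le> max_exp\<close>, the value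
  \<open>k * max_exp + (n - k) * min_exp\<close> lies between \<open>n * min_exp\<close> and
  \<open>n * max_exp\<close>, whatever \<open>k\<close> is; this bounds supremum and infimum on one
  side. The points \<open>\<theta> \<omega>\<close> and \<open>z\<close> supply the opposite
  bounds.\<close>

lemma regular_limits:
  assumes reg: "regular z \<omega>"
    and small: "\<And>e. e > 0 \<Longrightarrow> \<exists>m N. osc_mean m < e \<and> bad_mean m N < e"
    and max_exp: "0 \<le> max_exp"
  shows "(\<lambda>n. ln \<bar>deriv (fwd (Y \<omega>) n) x\<bar> / real n) \<longlonglongrightarrow> (if circ_eq x (\<theta> \<omega>) then max_exp else min_exp)"
    and "(\<lambda>n. ln (supder (fwd (Y \<omega>) n)) / real n) \<longlonglongrightarrow> max_exp"
    and "(\<lambda>n. ln (infder (fwd (Y \<omega>) n)) / real n) \<longlonglongrightarrow> min_exp"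
proof -
  have \<omega>: "\<omega> \<in> space PM" and z: "\<not> circ_eq z (\<theta> \<omega>)" using reg by (auto simp: regular_def)
  let ?F = "fwd (Y \<omega>)"
  note F = Fn_lift[OF \<omega>]
  have off: "(\<lambda>n. ln \<bar>deriv (?F n) x\<bar> / real n) \<longlonglongrightarrow> min_exp" if x: "\<not> circ_eq x (\<theta> \<omega>)" for x
  proof (rule tendstoI)
    fix e :: real assume e: "e > 0"
    have "dS1 x (\<theta> \<omega>) \<noteq> 0" using x by (simp add: dS1_eq_0_iff)
    then have x': "dS1 x (\<theta> \<omega>) > 0" using dS1_nonneg[of x "\<theta> \<omega>"] by simp
    have e2: "e / 2 > 0" using e by simp
    show "\<forall>\<^sub>F n in sequentially. dist (ln \<bar>deriv (?F n) x\<bar> / real n) min_exp < e"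
      using regular_uniform_away[OF reg x' e2] eventually_gt_at_top[of 0]
    proof eventually_elim
      case (elim n)
      then have "\<bar>ln \<bar>deriv (?F n) x\<bar> - real n * min_exp\<bar> \<le> e / 2 * real n" by blast
      moreover have "ln \<bar>deriv (?F n) x\<bar> - real n * min_exp = (ln \<bar>deriv (?F n) x\<bar> / real n - min_exp) * real n"
        using elim by (simp add: field_simps)
      ultimately have "\<bar>ln \<bar>deriv (?F n) x\<bar> / real n - min_exp\<bar> * real n \<le> e / 2 * real n"
        by (simp add: abs_mult)
      then show ?case using elim e by (simp add: dist_real_def)
    qed
  qed
  have on: "(\<lambda>n. ln \<bar>deriv (?F n) x\<bar> / real n) \<longlonglongrightarrow> max_exp" if x: "circ_eq x (\<theta> \<omega>)" for x
  proof -
    have "ln \<bar>deriv (?F n) x\<bar> = (\<Sum>j<n. \<psi> (\<omega> j) (?F j (\<theta> \<omega>)))" for n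
      unfolding ln_deriv_eq_sum[OF \<omega>]
      by (intro sum.cong refl \<psi>_circ_eq space_PM_D[OF \<omega>] circle_lift_circ_eq[OF F x])
    with reg show ?thesis unfolding regular_def by simp
  qed
  show "(\<lambda>n. ln \<bar>deriv (fwd (Y \<omega>) n) x\<bar> / real n) \<longlonglongrightarrow> (if circ_eq x (\<theta> \<omega>) then max_exp else min_exp)"
    using on off by simp
  note c = min_exp_nonpos[OF reg]
  have bounds: "\<forall>\<^sub>F n in sequentially. \<forall>x. ln \<bar>deriv (?F n) x\<bar> \<le> (max_exp + e) * real n \<and> (min_exp - e) * real n \<le> ln \<bar>deriv (?F n) x\<bar>"
    if e: "e > 0" for e
  proof -
    have "\<forall>\<^sub>F n in sequentially. \<forall>x. \<exists>k\<le>n.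
           \<bar>ln \<bar>deriv (?F n) x\<bar> - (real k * max_exp + real (n - k) * min_exp)\<bar> \<le> e * real n"
      by (rule regular_sandwich[OF reg e]) (rule small)
    then show ?thesis
    proof eventually_elim
      case (elim n)
      show ?case
      proof
        fix x
        obtain k where k: "k \<le> n" "\<bar>ln \<bar>deriv (?F n) x\<bar> - (real k * max_exp + real (n - k) * min_exp)\<bar> \<le> e * real n"
          using elim by blast
        have "real k * max_exp + real (n - k) * min_exp \<le> real n * max_exp + 0"
          using k(1) c max_exp by (intro add_mono mult_right_mono mult_nonneg_nonpos) auto
        moreover have "0 + real n * min_exp \<le> real k * max_exp + real (n - k) * min_exp"
          using k(1) c max_exp by (intro add_mono mult_right_mono_neg mult_nonneg_nonneg) auto
        ultimately show "ln \<bar>deriv (?F n) x\<bar> \<le> (max_exp + e) * real n \<and> (min_exp - e) * real n \<le> ln \<bar>deriv (?F n) x\<bar>"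
          using k(2) by (simp add: abs_le_iff algebra_simps)
      qed
    qed
  qed
  have pos: "\<bar>deriv (?F n) x\<bar> > 0" for n x using circle_lift_deriv_nz[OF F] by simp
  show "(\<lambda>n. ln (supder (?F n)) / real n) \<longlonglongrightarrow> max_exp"
  proof (rule order_tendstoI)
    fix a assume a: "a < max_exp"
    show "\<forall>\<^sub>F n in sequentially. a < ln (supder (?F n)) / real n"
      using order_tendstoD(1)[OF on[OF circ_eq_refl] a]
    proof eventually_elim
      case (elim n)
      have "ln \<bar>deriv (?F n) (\<theta> \<omega>)\<bar> / real n \<le> ln (supder (?F n)) / real n"
        using abs_deriv_le_supder[OF F] pos by (intro divide_right_mono ln_mono) auto
      with elim show ?case by simp
    qed
  next
    fix a assume a: "max_exp < a"
    define e where "e = (a - max_exp) / 2"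
    have e: "e > 0" using a by (simp add: e_def)
    show "\<forall>\<^sub>F n in sequentially. ln (supder (?F n)) / real n < a"
      using bounds[OF e] eventually_gt_at_top[of 0]
    proof eventually_elim
      case (elim n)
      have "\<bar>deriv (?F n) x\<bar> \<le> exp ((max_exp + e) * real n)" for x
        using elim(1) pos[of n x] by (metis exp_le_cancel_iff exp_ln)
      then have "supder (?F n) \<le> exp ((max_exp + e) * real n)"
        unfolding supder_def by (intro cSUP_least) auto
      then have "ln (supder (?F n)) \<le> (max_exp + e) * real n"
        using supder_pos[OF F, of n] by (metis exp_le_cancel_iff exp_ln)
      then have "ln (supder (?F n)) / real n \<le> max_exp + e" using elim(2) by (simp add: field_simps)
      also have "\<dots> < a" using a by (simp add: e_def field_simps)
      finally show ?case .
    qed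
  qed
  show "(\<lambda>n. ln (infder (?F n)) / real n) \<longlonglongrightarrow> min_exp"
  proof (rule order_tendstoI)
    fix a assume a: "min_exp < a"
    show "\<forall>\<^sub>F n in sequentially. ln (infder (?F n)) / real n < a"
      using order_tendstoD(2)[OF off[OF z] a]
    proof eventually_elim
      case (elim n)
      have "ln (infder (?F n)) / real n \<le> ln \<bar>deriv (?F n) z\<bar> / real n"
        using infder_le_abs_deriv[OF F] infder_pos[OF F] by (intro divide_right_mono ln_mono) auto
      with elim show ?case by simp
    qed
  next
    fix a assume a: "a < min_exp"
    define e where "e = (min_exp - a) / 2"
    have e: "e > 0" using a by (simp add: e_def)
    show "\<forall>\<^sub>F n in sequentially. a < ln (infder (?F n)) / real n"
      using bounds[OF e] eventually_gt_at_top[of 0]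
    proof eventually_elim
      case (elim n)
      have "exp ((min_exp - e) * real n) \<le> \<bar>deriv (?F n) x\<bar>" for x
        using elim(1) pos[of n x] by (metis exp_le_cancel_iff exp_ln)
      then have "exp ((min_exp - e) * real n) \<le> infder (?F n)"
        unfolding infder_def by (intro cINF_greatest) auto
      then have "(min_exp - e) * real n \<le> ln (infder (?F n))"
        using infder_pos[OF F, of n] by (simp add: ln_ge_iff)
      then have "min_exp - e \<le> ln (infder (?F n)) / real n" using elim(2) by (simp add: field_simps)
      moreover have "a < min_exp - e" using a by (simp add: e_def field_simps)
      ultimately show ?case by simp
    qed
  qed
qed

end

section \<open>Equivariance of the limit points over bi-infinite sequences\<close>

lemma invbwd_Suc_front: "invbwd Y (Suc n) x = inv (Y 0) (invbwd (\<lambda>i. Y (i + 1)) n x)"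
  by (induction n arbitrary: x) simp_all

lemma bwd_Suc_front: "bwd Y (Suc n) x = Y 0 (bwd (\<lambda>i. Y (i + 1)) n x)"
  by (induction n arbitrary: x) simp_all

lemma (in prob_space) AE_imp_ex:
  assumes "AE x in M. Q x" shows "\<exists>x. Q x"
proof (rule ccontr)
  assume "\<nexists>x. Q x"
  with assms have "AE x in M. False" by simp
  then show False by (simp add: AE_False)
qed

context circle_cocycle
begin

lemma measurable_W0 [measurable]: "(\<lambda>w. w 0) \<in> measurable WM M"
  by (rule measurable_component_singleton) simp

lemma distr_W0: "distr WM M (\<lambda>w. w 0) = M"
  by (rule W.PiM_component) simp

lemma space_WM_D: "w \<in> space WM \<Longrightarrow> w i \<in> space M"
  by (auto simp: space_PiM)

lemma space_future: "w \<in> space WM \<Longrightarrow> future w \<in> space PM"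
  by (rule measurable_space[OF measurable_future])

lemma future_left_shift: "future (left_shift k w) = tl_seq k (future w)"
  by (rule ext) (rule future_shift)

lemma integrable_W0: "integrable M g \<Longrightarrow> integrable WM (\<lambda>w. g (w 0))" for g :: "'a \<Rightarrow> real"
  using integrable_distr_eq[OF measurable_W0, of g] by (simp add: distr_W0)

lemma integral_W0: "g \<in> borel_measurable M \<Longrightarrow> (\<integral>w. g (w 0) \<partial>WM) = (\<integral>f. g f \<partial>M)" for g :: "'a \<Rightarrow> real"
  using integral_distr[OF measurable_W0, of g] by (simp add: distr_W0)

lemma integrable_W_h_bound:
  fixes G :: "(int \<Rightarrow> 'a) \<Rightarrow> real"
  assumes "G \<in> borel_measurable WM" "\<And>w. w \<in> space WM \<Longrightarrow> \<bar>G w\<bar> \<le> h (w 0)"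
  shows "integrable WM G"
  by (rule Bochner_Integration.integrable_bound[OF integrable_W0[OF h_integrable] assms(1)])
     (use assms(2) in \<open>auto intro!: AE_I2 order.trans[OF _ abs_ge_self]\<close>)

lemma measurable_\<theta>_future [measurable]: "(\<lambda>w. \<theta> (future w)) \<in> borel_measurable WM"
  by (rule measurable_compose[OF measurable_future \<theta>_measurable])

lemma measurable_\<pi>_past [measurable]: "(\<lambda>w. \<pi> (past w)) \<in> borel_measurable WM"
  by (rule measurable_compose[OF measurable_past \<pi>_measurable])

lemma measurable_invbwd_future [measurable]: "(\<lambda>w. invbwd (Y (future w)) n x) \<in> borel_measurable WM"
  by (rule measurable_compose[OF measurable_future measurable_invbwd]) simp

lemma measurable_bad [measurable]: "Measurable.pred WM (\<lambda>w. bad m N (\<pi> (past w)) (future w))"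
  unfolding bad_def by measurable

lemma AE_\<theta>_lim: "AE \<omega> in PM. \<forall>q\<in>\<rat>. (\<lambda>n. dS1 (invbwd (Y \<omega>) n q) (\<theta> \<omega>)) \<longlonglongrightarrow> 0"
  by (subst AE_ball_countable[OF countable_rat]) (use \<theta>_lim in blast)

text \<open>Splitting off the outermost inverse shows that the approximations of
  \<open>\<theta>\<close> are images under \<open>inv f\<close> of those for the shifted sequence;
  uniqueness of limits gives \<open>\<theta>\<close> as \<open>inv f\<close> of the shifted
  \<open>\<theta>\<close>, and applying \<open>f\<close> finishes.\<close>

lemma AE_\<theta>_equivariant:
  "AE w in WM. circ_eq (act (future w 0) (\<theta> (future w))) (\<theta> (tl_seq 1 (future w)))"
proof -
  note lim = AE_future[OF \<theta>_lim[of 0]]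
  from AE_shift[OF lim, unfolded future_left_shift]
  have "AE w in WM. (\<lambda>n. dS1 (invbwd (Y (tl_seq 1 (future w))) n 0) (\<theta> (tl_seq 1 (future w)))) \<longlonglongrightarrow> 0"
    by eventually_elim (rule spec)
  with lim AE_space show ?thesis
  proof eventually_elim
    case (elim w)
    let ?f = "act (future w 0)"
    have f: "circle_lift ?f" using elim(2) by (intro Y_lift space_future)
    from circle_lift_dS1_tendsto[OF circle_lift_inv[OF f] elim(3)]
    have "(\<lambda>n. dS1 (invbwd (Y (future w)) (Suc n) 0) (inv ?f (\<theta> (tl_seq 1 (future w))))) \<longlonglongrightarrow> 0"
      by (simp only: invbwd_Suc_front)
    from dS1_tendsto_unique[OF LIMSEQ_Suc[OF elim(1)] this]
    have "circ_eq (?f (\<theta> (future w))) (?f (inv ?f (\<theta> (tl_seq 1 (future w)))))"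
      by (rule circle_lift_circ_eq[OF f])
    then show ?case by (simp only: circle_lift_f_inv[OF f])
  qed
qed

text \<open>A shift puts the map \<open>w 0\<close> in front of the past, hence outermost in
  \<open>bwd\<close>, and this map passes through the limit by continuity.\<close>

lemma AE_\<pi>_equivariant:
  "AE w in WM. circ_eq (act (w 0) (\<pi> (past w))) (\<pi> (past (left_shift 1 w)))"
proof -
  note lim = AE_past[OF \<pi>_lim[of 0]]
  from AE_shift[OF lim] have "AE w in WM. (\<lambda>n. dS1 (bwd (Y (past (left_shift 1 w))) n 0) (\<pi> (past (left_shift 1 w)))) \<longlonglongrightarrow> 0"
    by eventually_elim blast
  with lim AE_space show ?thesis
  proof eventually_elim
    case (elim w)
    have f: "circle_lift (act (w 0))" using elim(2) by (intro lift space_WM_D)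
    have p: "past (left_shift 1 w) = case_nat (w 0) (past w)"
      using past_shift_Suc[of 0 w] by (simp add: future_def)
    have "bwd (Y (past (left_shift 1 w))) (Suc n) 0 = act (w 0) (bwd (Y (past w)) n 0)" for n
      unfolding bwd_Suc_front p by simp
    with LIMSEQ_Suc[OF elim(3)]
    have "(\<lambda>n. dS1 (act (w 0) (bwd (Y (past w)) n 0)) (\<pi> (past (left_shift 1 w)))) \<longlonglongrightarrow> 0" by (simp only:)
    from dS1_tendsto_unique[OF circle_lift_dS1_tendsto[OF f elim(1)] this] show ?case .
  qed
qed

lemma AE_\<theta>_orbit:
  "AE w in WM. \<forall>j. circ_eq (fwd (Y (future w)) j (\<theta> (future w))) (\<theta> (tl_seq j (future w)))"
  using AE_shift[OF AE_\<theta>_equivariant] AE_space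
proof eventually_elim
  case (elim w)
  have step: "circ_eq (act (future w j) (\<theta> (tl_seq j (future w)))) (\<theta> (tl_seq (Suc j) (future w)))" for j
    using elim(1)[rule_format, of j] by (simp add: future_left_shift)
  show ?case
  proof
    fix j
    show "circ_eq (fwd (Y (future w)) j (\<theta> (future w))) (\<theta> (tl_seq j (future w)))"
    proof (induction j)
      case (Suc j)
      have "circ_eq (act (future w j) (fwd (Y (future w)) j (\<theta> (future w)))) (act (future w j) (\<theta> (tl_seq j (future w))))"
        by (rule circle_lift_circ_eq[OF Y_lift[OF space_future[OF elim(2)]] Suc])
      from circ_eq_trans[OF this step] show ?case by simp
    qed simp
  qed
qed

lemma AE_\<pi>_orbit:
  "AE w in WM. \<forall>j. circ_eq (\<pi> (past (left_shift j w))) (fwd (Y (future w)) j (\<pi> (past w)))"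
  using AE_shift[OF AE_\<pi>_equivariant] AE_space
proof eventually_elim
  case (elim w)
  have step: "circ_eq (\<pi> (past (left_shift (Suc j) w))) (act (future w j) (\<pi> (past (left_shift j w))))" for j
    using circ_eq_sym[OF elim(1)[rule_format, of j]] by (simp add: future_def left_shift_def[of j w 0])
  show ?case
  proof
    fix j
    show "circ_eq (\<pi> (past (left_shift j w))) (fwd (Y (future w)) j (\<pi> (past w)))"
    proof (induction j)
      case (Suc j)
      from circ_eq_trans[OF step circle_lift_circ_eq[OF Y_lift[OF space_future[OF elim(2)]] Suc]]
      show ?case by simp
    qed simp
  qed
qed

text \<open>The coincidence of \<open>\<pi> (past w)\<close> and \<open>\<theta> (future w)\<close> is a shift-invariant event. If it had full
  measure, then by independence of past and future both maps would be almost surely equal to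
  a common constant, which equivariance would make a fixed point of almost every map.\<close>

lemma AE_\<pi>_neq_\<theta>: "AE w in WM. \<not> circ_eq (\<pi> (past w)) (\<theta> (future w))"
proof -
  define E where "E = {w\<in>space WM. dS1 (\<pi> (past w)) (\<theta> (future w)) = 0}"
  have "(\<lambda>w. dS1 (\<pi> (past w)) (\<theta> (future w))) \<in> borel_measurable WM"
    by (rule borel_measurable_dS1[OF measurable_\<pi>_past measurable_\<theta>_future])
  from measurable_sets[OF this, of "{0}"] have E: "E \<in> sets WM"
    by (simp add: E_def vimage_def Int_def conj_commute)
  \<comment> \<open>Equivariance holds only almost surely, so \<open>E\<close> is only almost
    invariant and the definition of ergodicity does not apply directly. The averages of its
    indicator are almost surely constant in \<open>n\<close> and also converge to the measure of
    \<open>E\<close>.\<close>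
  have "AE w in WM. (\<lambda>n. (\<Sum>j<n. indicator E (left_shift j w)) / real n) \<longlonglongrightarrow> (\<integral>w. indicator E w \<partial>WM)"
    by (rule birkhoff_shift, rule integrable_real_indicator[OF E]) (simp add: W.P.emeasure_eq_measure)
  then have const: "AE w in WM. indicator E w = measure WM E"
    using AE_\<pi>_orbit AE_\<theta>_orbit AE_space
  proof eventually_elim
    case (elim w)
    have "left_shift j w \<in> E \<longleftrightarrow> w \<in> E" for j
    proof -
      let ?F = "fwd (Y (future w)) j"
      have F: "circle_lift ?F" by (rule Fn_lift[OF space_future[OF elim(4)]])
      have "left_shift j w \<in> E \<longleftrightarrow> dS1 (\<pi> (past (left_shift j w))) (\<theta> (tl_seq j (future w))) = 0"
        unfolding E_def using measurable_space[OF measurable_shift elim(4), of j] by (simp add: future_left_shift)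
      also have "\<dots> \<longleftrightarrow> dS1 (?F (\<pi> (past w))) (?F (\<theta> (future w))) = 0"
        using dS1_cong[OF elim(2)[rule_format, of j] circ_eq_sym[OF elim(3)[rule_format, of j]]] by simp
      also have "\<dots> \<longleftrightarrow> dS1 (\<pi> (past w)) (\<theta> (future w)) = 0"
        unfolding dS1_eq_0_iff using circle_lift_circ_eq[OF F] circle_lift_circ_eq[OF circle_lift_inv[OF F]]
        by (metis circle_lift_inv_f[OF F])
      finally show ?thesis unfolding E_def using elim(4) by simp
    qed
    then have ind: "indicator E (left_shift j w) = (indicator E w :: real)" for j by (simp add: indicator_def)
    have l1: "(\<lambda>n. (\<Sum>j<n. indicator E w) / real n) \<longlonglongrightarrow> (\<integral>w. indicator E w \<partial>WM)" using elim(1) unfolding ind .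
    have l2: "(\<lambda>n. (\<Sum>j<n. indicator E w :: real) / real n) \<longlonglongrightarrow> indicator E w"
      by (rule tendsto_eventually, rule eventually_sequentiallyI[of 1]) simp
    from LIMSEQ_unique[OF l2 l1] E show ?case by simp
  qed
  have ne: "measure WM E \<noteq> 1"
  proof
    assume "measure WM E = 1"
    with const have "AE w in WM. circ_eq (\<pi> (past w)) (\<theta> (future w))"
      by (auto elim!: eventually_mono simp: indicator_def E_def dS1_eq_0_iff split: if_splits)
    then have "AE \<omega>' in PM. AE \<omega> in PM. circ_eq (\<pi> \<omega>') (\<theta> \<omega>)" by (rule AE_glue)
    \<comment> \<open>The constant is \<open>p = \<pi> \<omega>'\<close> for one typical frozen past
      \<open>\<omega>'\<close>.\<close>
    then obtain p where p: "AE \<omega> in PM. circ_eq p (\<theta> \<omega>)"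
      using P.P.AE_imp_ex by blast
    have "AE w in WM. circ_eq (act (w 0) p) p"
      using AE_shift[OF AE_future[OF p]] AE_\<theta>_equivariant AE_space
    proof eventually_elim
      case (elim w)
      have p1: "circ_eq p (\<theta> (future w))" and p2: "circ_eq p (\<theta> (tl_seq 1 (future w)))"
        using elim(1)[rule_format, of 0] elim(1)[rule_format, of 1] by (simp_all add: future_left_shift)
      have "circ_eq (act (w 0) p) (act (w 0) (\<theta> (future w)))"
        by (rule circle_lift_circ_eq[OF lift[OF space_WM_D[OF elim(3)]] p1])
      also have "circ_eq \<dots> (\<theta> (tl_seq 1 (future w)))" using elim(2) by (simp add: future_def)
      also have "circ_eq \<dots> p" by (rule circ_eq_sym[OF p2])
      finally show ?case .
    qed
    then have "AE f in distr WM M (\<lambda>w. w 0). circ_eq (act f p) p"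
      by (subst AE_distr_iff) (auto simp flip: dS1_eq_0_iff)
    then have "AE f in M. circ_eq (act f p) p" unfolding distr_W0 .
    with no_fixed_point show False by blast
  qed
  from const AE_space show ?thesis
    by eventually_elim (use ne in \<open>auto simp: indicator_def E_def dS1_eq_0_iff split: if_splits\<close>)
qed

lemma integrable_bad: "integrable WM (\<lambda>w. of_bool (bad m N (\<pi> (past w)) (future w)) * h (w 0))"
  by (rule integrable_W_h_bound) (auto simp: of_bool_def h_nonneg space_WM_D)

text \<open>The order of choice matters: \<open>m\<close> is fixed first, making
  \<open>osc_mean\<close> and the weight of closeness to the repelling point small. For this
  \<open>m\<close> the late-contraction part of \<open>bad\<close> disappears as \<open>N\<close>
  grows. Both limits are dominated by \<open>h\<close>.\<close>

lemma bad_mean_small: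
  assumes e: "e > 0"
  shows "\<exists>m N. osc_mean m < e \<and> bad_mean m N < e"
proof -
  define near where "near m = (\<integral>w. of_bool (dS1 (\<pi> (past w)) (\<theta> (future w)) \<le> 1 / real (Suc m)) * h (w 0) \<partial>WM)" for m
  have "near \<longlonglongrightarrow> (\<integral>w. 0 \<partial>WM)"
    unfolding near_def
  proof (rule integral_dominated_convergence[where w="\<lambda>w. h (w 0)"])
    show "AE w in WM. (\<lambda>m. of_bool (dS1 (\<pi> (past w)) (\<theta> (future w)) \<le> 1 / real (Suc m)) * h (w 0)) \<longlonglongrightarrow> 0"
      using AE_\<pi>_neq_\<theta>
    proof eventually_elim
      case (elim w)
      then have pos: "0 < dS1 (\<pi> (past w)) (\<theta> (future w))"
        using dS1_nonneg[of "\<pi> (past w)" "\<theta> (future w)"] by (auto simp: less_le simp flip: dS1_eq_0_iff)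
      have "(\<lambda>m. 1 / real (Suc m)) \<longlonglongrightarrow> 0" by (rule LIMSEQ_Suc[OF lim_const_over_n])
      from order_tendstoD(2)[OF this pos]
      have "\<forall>\<^sub>F m in sequentially. of_bool (dS1 (\<pi> (past w)) (\<theta> (future w)) \<le> 1 / real (Suc m)) * h (w 0) = 0"
        by eventually_elim simp
      then show ?case by (rule tendsto_eventually)
    qed
  qed (auto simp: integrable_W0 h_integrable of_bool_def h_nonneg space_WM_D intro!: AE_I2)
  then have "near \<longlonglongrightarrow> 0" by simp
  from eventually_conj[OF order_tendstoD(2)[OF this e] order_tendstoD(2)[OF osc_mean_tendsto e]]
  obtain m where m: "near m < e" "osc_mean m < e"
    unfolding osc_mean_def eventually_sequentially by blast
  have "(\<lambda>N. bad_mean m N) \<longlonglongrightarrow> near m"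
    unfolding near_def bad_mean_def
  proof (rule integral_dominated_convergence[where w="\<lambda>w. h (w 0)"])
    show "AE w in WM. (\<lambda>N. of_bool (bad m N (\<pi> (past w)) (future w)) * h (w 0))
        \<longlonglongrightarrow> of_bool (dS1 (\<pi> (past w)) (\<theta> (future w)) \<le> 1 / real (Suc m)) * h (w 0)"
      using AE_future[OF AE_\<theta>_lim]
    proof eventually_elim
      case (elim w)
      have "\<forall>\<^sub>F k in sequentially. \<forall>i\<in>{..<Suc m}. dS1 (invbwd (Y (future w)) k (real i / real (Suc m))) (\<theta> (future w)) < 1 / real (Suc m)"
        using elim by (intro eventually_ball_finite ballI order_tendstoD(2)[where y=0]) auto
      then obtain K where K: "\<And>k i. k \<ge> K \<Longrightarrow> i < Suc m \<Longrightarrow> dS1 (invbwd (Y (future w)) k (real i / real (Suc m))) (\<theta> (future w)) < 1 / real (Suc m)"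
        unfolding eventually_sequentially by (metis lessThan_iff)
      have "bad m N (\<pi> (past w)) (future w) \<longleftrightarrow> dS1 (\<pi> (past w)) (\<theta> (future w)) \<le> 1 / real (Suc m)" if "N \<ge> K" for N
        unfolding bad_def using K that by (meson le_trans not_le)
      then show ?case by (intro tendsto_eventually eventually_sequentiallyI[of K]) simp
    qed
  qed (auto simp: integrable_W0 h_integrable of_bool_def h_nonneg space_WM_D intro!: AE_I2)
  from order_tendstoD(2)[OF this m(1)] obtain N where "bad_mean m N < e"
    unfolding eventually_sequentially by blast
  with m show ?thesis by blast
qed

text \<open>The ergodic theorem is applied to observables of past and future on the bi-infinite
  space; equivariance then rewrites the shifted limit points as the forward orbits of
  \<open>\<pi> (past w)\<close> and \<open>\<theta> (future w)\<close>.\<close>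

lemma AE_regular: "AE w in WM. regular (\<pi> (past w)) (future w)"
proof -
  have osc: "AE w in WM. \<forall>m. (\<lambda>n. (\<Sum>j<n. osc m (left_shift j w 0)) / real n) \<longlonglongrightarrow> osc_mean m"
    unfolding AE_all_countable
    using birkhoff_shift[OF integrable_W0[OF integrable_osc]] by (simp add: integral_W0 osc_mean_def)
  have hh: "AE w in WM. (\<lambda>n. (\<Sum>j<n. h (left_shift j w 0)) / real n) \<longlonglongrightarrow> (\<integral>f. h f \<partial>M)"
    using birkhoff_shift[OF integrable_W0[OF h_integrable]] by (simp add: integral_W0)
  have mi: "AE w in WM. (\<lambda>n. (\<Sum>j<n. \<psi> (left_shift j w 0) (\<pi> (past (left_shift j w)))) / real n) \<longlonglongrightarrow> min_exp"
    unfolding min_exp_def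
    by (rule birkhoff_shift[where G="\<lambda>w. \<psi> (w 0) (\<pi> (past w))"], rule integrable_W_h_bound)
       (auto intro!: \<psi>_bound space_WM_D)
  have ma: "AE w in WM. (\<lambda>n. (\<Sum>j<n. \<psi> (left_shift j w 0) (\<theta> (future (left_shift j w)))) / real n) \<longlonglongrightarrow> max_exp"
    unfolding max_exp_def
    by (rule birkhoff_shift[where G="\<lambda>w. \<psi> (w 0) (\<theta> (future w))"], rule integrable_W_h_bound)
       (auto intro!: \<psi>_bound space_WM_D)
  have ba: "AE w in WM. \<forall>m N. (\<lambda>n. (\<Sum>j<n. of_bool (bad m N (\<pi> (past (left_shift j w))) (future (left_shift j w))) * h (left_shift j w 0)) / real n) \<longlonglongrightarrow> bad_mean m N"
    unfolding AE_all_countable bad_mean_def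
    by (intro allI birkhoff_shift[where G="\<lambda>w. of_bool (bad _ _ (\<pi> (past w)) (future w)) * h (w 0)"] integrable_bad)
  show ?thesis
    using AE_space AE_\<pi>_neq_\<theta> AE_future[OF AE_\<theta>_lim] AE_\<theta>_orbit AE_\<pi>_orbit osc hh mi ma ba
  proof eventually_elim
    case (elim w)
    let ?\<omega> = "future w" and ?z = "\<pi> (past w)"
    have w0: "left_shift j w 0 = ?\<omega> j" for j by (simp add: left_shift_def future_def)
    have \<omega>M: "?\<omega> j \<in> space M" for j by (rule space_PM_D[OF space_future[OF elim(1)]])
    have z: "\<psi> (?\<omega> j) (\<pi> (past (left_shift j w))) = \<psi> (?\<omega> j) (fwd (Y ?\<omega>) j ?z)" for j
      by (rule \<psi>_circ_eq[OF \<omega>M elim(5)[rule_format]])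
    have t: "\<psi> (?\<omega> j) (\<theta> (future (left_shift j w))) = \<psi> (?\<omega> j) (fwd (Y ?\<omega>) j (\<theta> ?\<omega>))" for j
      unfolding future_left_shift by (rule \<psi>_circ_eq[OF \<omega>M circ_eq_sym[OF elim(4)[rule_format]]])
    have b: "bad m N (\<pi> (past (left_shift j w))) (future (left_shift j w)) \<longleftrightarrow> bad m N (fwd (Y ?\<omega>) j ?z) (tl_seq j ?\<omega>)" for m N j
      unfolding future_left_shift bad_def using dS1_cong[OF elim(5)[rule_format, of j] circ_eq_refl] by simp
    show ?case
      unfolding regular_def
      using elim(1-4) elim(6-)[unfolded w0 z t b] space_future by blast
  qed
qed

section \<open>Time reversal and the exponents\<close>

lemma min_exp_le_0: "min_exp \<le> 0"
proof -
  obtain w where "regular (\<pi> (past w)) (future w)"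
    using W.P.AE_imp_ex[OF AE_regular] by blast
  then show ?thesis by (rule min_exp_nonpos)
qed

text \<open>The integral on the right is \<open>min_exp\<close> of the inverse maps. By equivariance
  the derivative at \<open>\<theta>\<close> is the reciprocal of the derivative of the inverse at
  the shifted \<open>\<theta>\<close>; reflection then lets this point be computed from the past
  instead of the future.\<close>

lemma max_exp_eq: "max_exp = - (\<integral>w. ln \<bar>deriv (inv (act (w 0))) (\<theta> (past w))\<bar> \<partial>WM)"
proof -
  let ?G = "\<lambda>f \<omega>. - \<psi> f (inv (act f) (\<theta> \<omega>))"
  have inv_deriv: "?G f \<omega> = ln \<bar>deriv (inv (act f)) (\<theta> \<omega>)\<bar>" if "f \<in> space M" for f \<omega>
    using lift[OF that] by (simp add: \<psi>_def circle_lift_deriv_inv abs_inverse ln_inverse circle_lift_deriv_nz)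
  have "(\<integral>w. \<psi> (w 0) (\<theta> (future w)) \<partial>WM) = (\<integral>w. - ?G (w 0) (future (left_shift 1 w)) \<partial>WM)"
  proof (rule integral_cong_AE)
    show "AE w in WM. \<psi> (w 0) (\<theta> (future w)) = - ?G (w 0) (future (left_shift 1 w))"
      using AE_\<theta>_equivariant AE_space
    proof eventually_elim
      case (elim w)
      let ?f = "act (w 0)"
      have f: "circle_lift ?f" using elim(2) by (intro lift space_WM_D)
      have "circ_eq (?f (\<theta> (future w))) (\<theta> (future (left_shift 1 w)))"
        using elim(1) by (simp add: future_left_shift future_def)
      from circle_lift_circ_eq[OF circle_lift_inv[OF f] this]
      have "circ_eq (\<theta> (future w)) (inv ?f (\<theta> (future (left_shift 1 w))))" by (simp add: circle_lift_inv_f[OF f])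
      from \<psi>_circ_eq[OF space_WM_D[OF elim(2)] this] show ?case by simp
    qed
    have [measurable]: "(\<lambda>w. \<theta> (future (left_shift 1 w))) \<in> borel_measurable WM"
      by (rule measurable_compose[OF measurable_shift measurable_\<theta>_future])
    show "(\<lambda>w. - ?G (w 0) (future (left_shift 1 w))) \<in> borel_measurable WM" by measurable
  qed measurable
  also have "\<dots> = - (\<integral>w. ?G (w 0) (past w) \<partial>WM)"
  proof -
    have "(\<lambda>p. ?G (fst p) (snd p)) \<in> borel_measurable (M \<Otimes>\<^sub>M PM)" by measurable
    from integral_reflect[OF this] show ?thesis by simp
  qed
  also have "(\<integral>w. ?G (w 0) (past w) \<partial>WM) = (\<integral>w. ln \<bar>deriv (inv (act (w 0))) (\<theta> (past w))\<bar> \<partial>WM)"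
    by (intro Bochner_Integration.integral_cong refl inv_deriv space_WM_D)
  finally show ?thesis unfolding max_exp_def .
qed

text \<open>Inverting every map turns \<open>invbwd\<close> into \<open>bwd\<close> and back. The
  same \<open>h\<close> serves, since the log-derivative only changes its sign and its base
  point.\<close>

lemma inverse_cocycle: "circle_cocycle M (\<lambda>f. inv (act f)) h \<theta> \<pi>"
proof unfold_locales
  have inv_inv: "inv (inv (act f)) = act f" if "f \<in> space M" for f
    by (rule inv_inv_eq[OF circle_lift_bij[OF lift[OF that]]])
  have deriv: "ln \<bar>deriv (inv (act f)) x\<bar> = - \<psi> f (inv (act f) x)" if "f \<in> space M" for f x
    using lift[OF that] by (simp add: \<psi>_def circle_lift_deriv_inv abs_inverse ln_inverse circle_lift_deriv_nz)
  show "circle_lift (inv (act f))" if "f \<in> space M" for f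
    by (rule circle_lift_inv[OF lift[OF that]])
  show "(\<lambda>p. inv (act (fst p)) (snd p)) \<in> borel_measurable (M \<Otimes>\<^sub>M borel)"
    by (rule inv_act_measurable)
  show "(\<lambda>p. inv (inv (act (fst p))) (snd p)) \<in> borel_measurable (M \<Otimes>\<^sub>M borel)"
    by (subst measurable_cong[OF fun_cong[OF inv_inv]]) (auto simp: space_pair_measure act_measurable)
  show "(\<lambda>p. ln \<bar>deriv (inv (act (fst p))) (snd p)\<bar>) \<in> borel_measurable (M \<Otimes>\<^sub>M borel)"
    by (subst measurable_cong[OF deriv]) (auto simp: space_pair_measure)
  show "integrable M h" by (rule h_integrable)
  show "\<bar>ln \<bar>deriv (inv (act f)) x\<bar>\<bar> \<le> h f" if "f \<in> space M" for f x
    using \<psi>_bound[OF that] by (simp add: deriv[OF that])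
  show "AE \<omega> in PM. (\<lambda>n. dS1 (bwd (\<lambda>i. inv (act (\<omega> i))) n x) (\<theta> \<omega>)) \<longlonglongrightarrow> 0" for x
    using \<theta>_lim[of x] unfolding invbwd_eq_bwd .
  show "AE \<omega> in PM. (\<lambda>n. dS1 (invbwd (\<lambda>i. inv (act (\<omega> i))) n x) (\<pi> \<omega>)) \<longlonglongrightarrow> 0" for x
    using \<pi>_lim[of x] AE_space
    by eventually_elim (simp add: invbwd_eq_bwd inv_inv space_PM_D)
  show "\<not> (\<exists>p. AE f in M. circ_eq (inv (act f) p) p)"
  proof
    assume "\<exists>p. AE f in M. circ_eq (inv (act f) p) p"
    then obtain p where "AE f in M. circ_eq (inv (act f) p) p" by blast
    then have "AE f in M. circ_eq (act f p) p" using AE_space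
    proof eventually_elim
      case (elim f)
      from circle_lift_circ_eq[OF lift[OF elim(2)] elim(1)] show ?case
        by (simp add: circle_lift_f_inv[OF lift[OF elim(2)]] circ_eq_sym)
    qed
    with no_fixed_point show False by blast
  qed
qed auto

lemma max_exp_nonneg: "0 \<le> max_exp"
proof -
  interpret I: circle_cocycle M "\<lambda>f. inv (act f)" h \<theta> \<pi> by (rule inverse_cocycle)
  show ?thesis using I.min_exp_le_0 unfolding max_exp_eq I.min_exp_def I.\<psi>_def by simp
qed

theorem exponents:
  "AE \<omega> in PM. (\<forall>x. (\<lambda>n. ln \<bar>deriv (fwd (Y \<omega>) n) x\<bar> / real n) \<longlonglongrightarrow> (if circ_eq x (\<theta> \<omega>) then max_exp else min_exp))
     \<and> (\<lambda>n. ln (supder (fwd (Y \<omega>) n)) / real n) \<longlonglongrightarrow> max_exp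
     \<and> (\<lambda>n. ln (infder (fwd (Y \<omega>) n)) / real n) \<longlonglongrightarrow> min_exp"
proof -
  \<comment> \<open>Freezing a typical past provides one \<open>z\<close> that is regular for almost
    every future; the limits no longer mention it.\<close>
  have "AE \<omega>' in PM. AE \<omega> in PM. regular (\<pi> \<omega>') \<omega>" by (rule AE_glue[OF AE_regular])
  then obtain z where "AE \<omega> in PM. regular z \<omega>"
    using P.P.AE_imp_ex by blast
  then show ?thesis
    by eventually_elim (intro conjI allI regular_limits bad_mean_small max_exp_nonneg)
qed

theorem exponents_inverse:
  "AE \<omega> in PM. \<forall>x. (\<lambda>n. ln \<bar>deriv (invfwd (Y \<omega>) n) x\<bar> / real n) \<longlonglongrightarrow> (if circ_eq x (\<pi> \<omega>) then - min_exp else - max_exp)"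
proof -
  interpret I: circle_cocycle M "\<lambda>f. inv (act f)" h \<theta> \<pi> by (rule inverse_cocycle)
  have mi: "I.min_exp = - max_exp"
    unfolding max_exp_eq I.min_exp_def I.\<psi>_def by simp
  have ma: "I.max_exp = - min_exp"
  proof -
    have "(\<integral>w. ln \<bar>deriv (inv (inv (act (w 0)))) (\<pi> (past w))\<bar> \<partial>WM) = min_exp"
      unfolding min_exp_def \<psi>_def
      by (intro Bochner_Integration.integral_cong refl)
         (simp add: inv_inv_eq circle_lift_bij lift space_WM_D)
    then show ?thesis unfolding I.max_exp_eq by simp
  qed
  from I.exponents show ?thesis
    unfolding invfwd_eq_fwd mi[symmetric] ma[symmetric] by eventually_elim blast
qed

end

section \<open>Measurability on the space of diffeomorphisms\<close>

text \<open>Rounding the second argument down to a multiple of \<open>1 / (n + 1)\<close> leaves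
  countably many values, each treated by \<open>meas\<close>; continuity recovers the limit.\<close>

lemma measurable_pair_of_continuous:
  fixes g :: "'a \<Rightarrow> real \<Rightarrow> real"
  assumes meas: "\<And>x. (\<lambda>f. g f x) \<in> borel_measurable M"
    and cont: "\<And>f. f \<in> space M \<Longrightarrow> continuous_on UNIV (g f)"
  shows "(\<lambda>p. g (fst p) (snd p)) \<in> borel_measurable (M \<Otimes>\<^sub>M borel)"
proof (rule borel_measurable_LIMSEQ_real)
  fix p assume "p \<in> space (M \<Otimes>\<^sub>M (borel :: real measure))"
  then have f: "fst p \<in> space M" by (auto simp: space_pair_measure)
  let ?x = "\<lambda>n. of_int \<lfloor>real (Suc n) * snd p\<rfloor> / real (Suc n)"
  have "?x \<longlonglongrightarrow> snd p"
  proof (rule tendsto_sandwich[where f="\<lambda>n. snd p - 1 / real (Suc n)" and h="\<lambda>_. snd p"])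
    have "(\<lambda>n. 1 / real (Suc n)) \<longlonglongrightarrow> 0" by (rule LIMSEQ_Suc[OF lim_const_over_n])
    from tendsto_diff[OF tendsto_const this, of "snd p"] show "(\<lambda>n. snd p - 1 / real (Suc n)) \<longlonglongrightarrow> snd p" by simp
    show "\<forall>\<^sub>F n in sequentially. snd p - 1 / real (Suc n) \<le> ?x n"
    proof (rule always_eventually, rule allI)
      fix n
      have "real (Suc n) * snd p - 1 \<le> of_int \<lfloor>real (Suc n) * snd p\<rfloor>" by linarith
      then have "(real (Suc n) * snd p - 1) / real (Suc n) \<le> ?x n" by (rule divide_right_mono) simp
      then show "snd p - 1 / real (Suc n) \<le> ?x n" by (simp add: diff_divide_distrib del: of_nat_Suc)
    qed
    show "\<forall>\<^sub>F n in sequentially. ?x n \<le> snd p"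
    proof (rule always_eventually, rule allI)
      fix n
      have "?x n \<le> (real (Suc n) * snd p) / real (Suc n)" by (rule divide_right_mono) auto
      then show "?x n \<le> snd p" by (simp del: of_nat_Suc)
    qed
  qed simp
  then show "(\<lambda>n. g (fst p) (?x n)) \<longlonglongrightarrow> g (fst p) (snd p)"
    using cont[OF f] by (intro isCont_tendsto_compose[where g="g (fst p)"]) (auto simp: continuous_on_eq_continuous_at)
next
  fix n
  show "(\<lambda>p. g (fst p) (of_int \<lfloor>real (Suc n) * snd p\<rfloor> / real (Suc n))) \<in> borel_measurable (M \<Otimes>\<^sub>M borel)"
  proof (rule measurable_compose_countable[where f="\<lambda>i p. g (fst p) (of_int i / real (Suc n))" and g="\<lambda>p. \<lfloor>real (Suc n) * snd p\<rfloor>"])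
    show "(\<lambda>p. g (fst p) (of_int i / real (Suc n))) \<in> borel_measurable (M \<Otimes>\<^sub>M borel)" for i
      by (rule measurable_compose[OF measurable_fst meas])
    show "(\<lambda>p. \<lfloor>real (Suc n) * snd p\<rfloor>) \<in> measurable (M \<Otimes>\<^sub>M borel) (count_space UNIV)"
      by measurable
  qed
qed

lemma circle_lift_monotone:
  assumes F: "circle_lift F"
  shows "(\<forall>x y. x < y \<longrightarrow> F x < F y) \<or> (\<forall>x y. x < y \<longrightarrow> F y < F x)"
proof -
  have nz: "deriv F x \<noteq> 0" for x by (rule circle_lift_deriv_nz[OF F])
  have "(\<forall>x. deriv F x > 0) \<or> (\<forall>x. deriv F x < 0)"
  proof (rule ccontr)
    assume "\<not> ?thesis"
    then obtain x y where "deriv F x \<le> 0" "0 \<le> deriv F y" by (meson not_le)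
    then have "\<exists>z\<in>closed_segment x y. deriv F z = 0"
      by (intro IVT'_closed_segment_real[OF _ circle_lift_deriv_continuous[OF F]])
         (auto simp: closed_segment_eq_real_ivl)
    with nz show False by blast
  qed
  then show ?thesis
  proof
    assume p: "\<forall>x. deriv F x > 0"
    have "F x < F y" if "x < y" for x y
      by (rule DERIV_pos_imp_increasing[OF that]) (use p circle_lift_DERIV[OF F] in blast)
    then show ?thesis by blast
  next
    assume p: "\<forall>x. deriv F x < 0"
    have "F y < F x" if "x < y" for x y
      by (rule DERIV_neg_imp_decreasing[OF that]) (use p circle_lift_DERIV[OF F] in blast)
    then show ?thesis by blast
  qed
qed

text \<open>Comparison of \<open>F 0\<close> with \<open>F 1\<close> detects the orientation, so
  superlevel sets of the inverse are described by finitely many values of \<open>F\<close>; this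
  yields measurability of inversion.\<close>

lemma less_inv_iff:
  assumes F: "circle_lift F"
  shows "a < inv F x \<longleftrightarrow> (F 0 < F 1 \<and> F a < x) \<or> (F 1 < F 0 \<and> x < F a)"
  using circle_lift_monotone[OF F]
proof
  assume m: "\<forall>x y. x < y \<longrightarrow> F x < F y"
  then have "F 0 < F 1" by simp
  moreover have "a < inv F x \<longleftrightarrow> F a < F (inv F x)" using m by (metis linorder_less_linear order_less_asym)
  ultimately show ?thesis by (simp add: circle_lift_f_inv[OF F])
next
  assume m: "\<forall>x y. x < y \<longrightarrow> F y < F x"
  then have "F 1 < F 0" by simp
  moreover have "a < inv F x \<longleftrightarrow> F (inv F x) < F a" using m by (metis linorder_less_linear order_less_asym)
  ultimately show ?thesis by (simp add: circle_lift_f_inv[OF F])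
qed

section \<open>Borel measurability with respect to the \<open>C1\<close> topology\<close>

lemma istopology_C1:
  "istopology (\<lambda>U. U \<subseteq> Diff1tau \<tau> \<and> (\<forall>F\<in>U. \<exists>e>0. \<forall>G\<in>Diff1tau \<tau>. dC1 F G < e \<longrightarrow> G \<in> U))"
  unfolding istopology_def
proof (intro conjI allI impI)
  fix S T assume S: "S \<subseteq> Diff1tau \<tau> \<and> (\<forall>F\<in>S. \<exists>e>0. \<forall>G\<in>Diff1tau \<tau>. dC1 F G < e \<longrightarrow> G \<in> S)"
    and T: "T \<subseteq> Diff1tau \<tau> \<and> (\<forall>F\<in>T. \<exists>e>0. \<forall>G\<in>Diff1tau \<tau>. dC1 F G < e \<longrightarrow> G \<in> T)"
  show "S \<inter> T \<subseteq> Diff1tau \<tau>" using S by blast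
  show "\<forall>F\<in>S \<inter> T. \<exists>e>0. \<forall>G\<in>Diff1tau \<tau>. dC1 F G < e \<longrightarrow> G \<in> S \<inter> T"
  proof
    fix F assume "F \<in> S \<inter> T"
    with S T obtain d e where "d > 0" "\<forall>G\<in>Diff1tau \<tau>. dC1 F G < d \<longrightarrow> G \<in> S"
      "e > 0" "\<forall>G\<in>Diff1tau \<tau>. dC1 F G < e \<longrightarrow> G \<in> T" by blast
    then show "\<exists>e>0. \<forall>G\<in>Diff1tau \<tau>. dC1 F G < e \<longrightarrow> G \<in> S \<inter> T"
      by (intro exI[of _ "min d e"]) auto
  qed
next
  fix K assume K: "\<forall>U\<in>K. U \<subseteq> Diff1tau \<tau> \<and> (\<forall>F\<in>U. \<exists>e>0. \<forall>G\<in>Diff1tau \<tau>. dC1 F G < e \<longrightarrow> G \<in> U)"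
  then show "\<Union>K \<subseteq> Diff1tau \<tau>" by blast
  show "\<forall>F\<in>\<Union>K. \<exists>e>0. \<forall>G\<in>Diff1tau \<tau>. dC1 F G < e \<longrightarrow> G \<in> \<Union>K"
  proof
    fix F assume "F \<in> \<Union>K"
    then obtain U where "U \<in> K" "F \<in> U" by blast
    with K obtain e where "e > 0" "\<forall>G\<in>Diff1tau \<tau>. dC1 F G < e \<longrightarrow> G \<in> U" by meson
    with \<open>U \<in> K\<close> show "\<exists>e>0. \<forall>G\<in>Diff1tau \<tau>. dC1 F G < e \<longrightarrow> G \<in> \<Union>K" by blast
  qed
qed

lemma openin_C1top:
  "openin (C1top \<tau>) U \<longleftrightarrow> U \<subseteq> Diff1tau \<tau> \<and> (\<forall>F\<in>U. \<exists>e>0. \<forall>G\<in>Diff1tau \<tau>. dC1 F G < e \<longrightarrow> G \<in> U)"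
  unfolding C1top_def by (subst topology_inverse'[OF istopology_C1]) (rule refl)

lemma
  assumes F: "circle_lift F" and G: "circle_lift G"
  shows dS1_le_dC1: "dS1 (F x) (G x) \<le> dC1 F G"
    and deriv_diff_le_dC1: "\<bar>deriv F x - deriv G x\<bar> \<le> dC1 F G"
proof -
  have b1: "bdd_above (range (\<lambda>x. dS1 (F x) (G x)))"
    by (rule bdd_aboveI[of _ "1/2"]) (use dS1_le_half in blast)
  have b2: "bdd_above (range (\<lambda>x. \<bar>deriv F x - deriv G x\<bar>))"
  proof (rule bdd_aboveI)
    fix y assume "y \<in> range (\<lambda>x. \<bar>deriv F x - deriv G x\<bar>)"
    then obtain x where "y = \<bar>deriv F x - deriv G x\<bar>" by (rule rangeE)
    then show "y \<le> supder F + supder G"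
      using abs_deriv_le_supder[OF F, of x] abs_deriv_le_supder[OF G, of x] by linarith
  qed
  have l1: "dS1 (F x) (G x) \<le> (SUP x. dS1 (F x) (G x))" for x by (rule cSUP_upper[OF UNIV_I b1])
  have l2: "\<bar>deriv F x - deriv G x\<bar> \<le> (SUP x. \<bar>deriv F x - deriv G x\<bar>)" for x by (rule cSUP_upper[OF UNIV_I b2])
  show "dS1 (F x) (G x) \<le> dC1 F G" using l1[of x] l2[of x] unfolding dC1_def by linarith
  show "\<bar>deriv F x - deriv G x\<bar> \<le> dC1 F G" using l1[of x] l2[of x] dS1_nonneg[of "F x" "G x"] unfolding dC1_def by linarith
qed

context
  fixes \<tau> :: real and \<nu> :: "(real \<Rightarrow> real) measure"
  assumes \<nu>: "borel_prob_Diff \<tau> \<nu>"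
begin

lemma space_\<nu>: "space \<nu> = Diff1tau \<tau>"
  using \<nu> by (simp add: borel_prob_Diff_def)

lemma space_\<nu>_lift: "f \<in> space \<nu> \<Longrightarrow> circle_lift f"
  by (simp add: space_\<nu> Diff1tau_circle_lift)

lemma open_measurable: "openin (C1top \<tau>) U \<Longrightarrow> U \<in> sets \<nu>"
  using \<nu> by (auto simp: borel_prob_Diff_def)

lemma measurable_lower_semicontinuous:
  fixes \<phi> :: "(real \<Rightarrow> real) \<Rightarrow> real"
  assumes "\<And>F a. F \<in> Diff1tau \<tau> \<Longrightarrow> a < \<phi> F \<Longrightarrow> \<exists>e>0. \<forall>G\<in>Diff1tau \<tau>. dC1 F G < e \<longrightarrow> a < \<phi> G"
  shows "\<phi> \<in> borel_measurable \<nu>"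
  unfolding borel_measurable_iff_greater
proof
  fix a
  show "{F \<in> space \<nu>. a < \<phi> F} \<in> sets \<nu>"
    by (rule open_measurable) (use assms in \<open>auto simp: openin_C1top space_\<nu>\<close>)
qed

lemma measurable_deriv_at: "(\<lambda>f. deriv f x) \<in> borel_measurable \<nu>"
proof (rule measurable_lower_semicontinuous)
  fix F a assume F: "F \<in> Diff1tau \<tau>" and a: "a < deriv F x"
  have "a < deriv G x" if "G \<in> Diff1tau \<tau>" "dC1 F G < deriv F x - a" for G
    using deriv_diff_le_dC1[OF Diff1tau_circle_lift[OF F] Diff1tau_circle_lift[OF that(1)], of x] that(2) by linarith
  with a show "\<exists>e>0. \<forall>G\<in>Diff1tau \<tau>. dC1 F G < e \<longrightarrow> a < deriv G x"
    by (intro exI[of _ "deriv F x - a"]) auto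
qed

text \<open>The normalisation makes this evaluation discontinuous: near a lift with
  \<open>F 0 = 0\<close> there can be lifts with value close to 1. The jump only goes upwards, so
  lower semicontinuity survives.\<close>

lemma measurable_at_0: "(\<lambda>f. f 0) \<in> borel_measurable \<nu>"
proof (rule measurable_lower_semicontinuous)
  fix F a assume F: "F \<in> Diff1tau \<tau>" and a: "a < F 0"
  have F01: "0 \<le> F 0" "F 0 < 1" using F by (auto simp: Diff1tau_def)
  show "\<exists>e>0. \<forall>G\<in>Diff1tau \<tau>. dC1 F G < e \<longrightarrow> a < G 0"
  proof (cases "a < 0")
    case True
    then show ?thesis by (intro exI[of _ 1]) (auto simp: Diff1tau_def intro: less_le_trans)
  next
    case False
    \<comment> \<open>The bound \<open>F 0 - a\<close> keeps \<open>G 0\<close> above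
      \<open>a\<close> once the integer \<open>l\<close> is 0 and, as \<open>0 \<le> a\<close>,
      excludes \<open>l \<le> -1\<close>; the bound \<open>1 - F 0\<close> excludes
      \<open>l \<ge> 1\<close>.\<close>
    have "a < G 0" if G: "G \<in> Diff1tau \<tau>" and less: "dC1 F G < min (F 0 - a) (1 - F 0)" for G
    proof -
      have G01: "0 \<le> G 0" "G 0 < 1" using G by (auto simp: Diff1tau_def)
      obtain l :: int where "dS1 (F 0) (G 0) = \<bar>F 0 - G 0 - of_int l\<bar>" by (rule dS1_attained)
      with less dS1_le_dC1[OF Diff1tau_circle_lift[OF F] Diff1tau_circle_lift[OF G], of 0]
      have l: "\<bar>F 0 - G 0 - of_int l\<bar> < F 0 - a" "\<bar>F 0 - G 0 - of_int l\<bar> < 1 - F 0" by linarith+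
      then have "l < 1" "l > -1" using G01 F01 False by linarith+
      then have "l = 0" by simp
      with l(1) show ?thesis by simp
    qed
    with a F01 show ?thesis by (intro exI[of _ "min (F 0 - a) (1 - F 0)"]) auto
  qed
qed

text \<open>The increment from 0 to \<open>x\<close> is governed by the derivative alone and is free
  of the jump caused by the normalisation; the value at 0 is added afterwards.\<close>

lemma measurable_eval: "(\<lambda>f. f x) \<in> borel_measurable \<nu>"
proof -
  have "(\<lambda>f. f x - f 0) \<in> borel_measurable \<nu>"
  proof (rule measurable_lower_semicontinuous)
    fix F a assume F: "F \<in> Diff1tau \<tau>" and a: "a < F x - F 0"
    define e where "e = (F x - F 0 - a) / (\<bar>x\<bar> + 1)"
    have e: "e > 0" using a by (simp add: e_def)
    have "a < G x - G 0" if G: "G \<in> Diff1tau \<tau>" and less: "dC1 F G < e" for G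
    proof -
      note FL = Diff1tau_circle_lift[OF F] and GL = Diff1tau_circle_lift[OF G]
      have "norm ((F x - G x) - (F 0 - G 0)) \<le> e * norm (x - 0)"
      proof (rule field_differentiable_bound[where S=UNIV and f="\<lambda>x. F x - G x" and f'="\<lambda>x. deriv F x - deriv G x"])
        show "((\<lambda>x. F x - G x) has_field_derivative deriv F z - deriv G z) (at z within UNIV)" for z
          by (intro DERIV_diff circle_lift_DERIV FL GL)
        show "norm (deriv F z - deriv G z) \<le> e" for z
          using deriv_diff_le_dC1[OF FL GL, of z] less by simp
      qed auto
      moreover have "e * (\<bar>x\<bar> + 1) = F x - F 0 - a" by (simp add: e_def)
      ultimately show ?thesis using e by (simp add: algebra_simps abs_le_iff)
    qed
    with e show "\<exists>e>0. \<forall>G\<in>Diff1tau \<tau>. dC1 F G < e \<longrightarrow> a < G x - G 0" by blast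
  qed
  from borel_measurable_add[OF this measurable_at_0] show ?thesis by simp
qed

lemma measurable_inv_at: "(\<lambda>f. inv f x) \<in> borel_measurable \<nu>"
  unfolding borel_measurable_iff_greater
proof
  fix a
  note [measurable] = measurable_eval
  have "{f \<in> space \<nu>. a < inv f x} = {f \<in> space \<nu>. (f 0 < f 1 \<and> f a < x) \<or> (f 1 < f 0 \<and> x < f a)}"
    using less_inv_iff[OF space_\<nu>_lift] by blast
  also have "\<dots> \<in> sets \<nu>" by measurable
  finally show "{f \<in> space \<nu>. a < inv f x} \<in> sets \<nu>" .
qed

text \<open>The maps moving \<open>p\<close> form an open set. If it is null it misses the support,
  so \<open>p\<close> is fixed by the support and then by the semigroup it generates.\<close>

lemma no_common_fixed_point:
  assumes "\<not> fixes_point (semigrp (supp \<tau> \<nu>))"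
  shows "\<not> (\<exists>p. AE f in \<nu>. circ_eq (f p) p)"
proof
  assume "\<exists>p. AE f in \<nu>. circ_eq (f p) p"
  then obtain p where p: "AE f in \<nu>. circ_eq (f p) p" by blast
  have fix_supp: "circ_eq (f p) p" if f: "f \<in> supp \<tau> \<nu>" for f
  proof (rule ccontr)
    assume nf: "\<not> circ_eq (f p) p"
    define U where "U = {g \<in> Diff1tau \<tau>. \<not> circ_eq (g p) p}"
    have U: "openin (C1top \<tau>) U"
      unfolding openin_C1top
    proof (intro conjI ballI)
      fix F assume "F \<in> U"
      then have F: "F \<in> Diff1tau \<tau>" and pos: "dS1 (F p) p > 0"
        using dS1_nonneg[of "F p" p] by (auto simp: U_def less_le simp flip: dS1_eq_0_iff)
      have "G \<in> U" if G: "G \<in> Diff1tau \<tau>" "dC1 F G < dS1 (F p) p" for G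
        using dS1_le_dC1[OF Diff1tau_circle_lift[OF F] Diff1tau_circle_lift[OF G(1)], of p] G
          dS1_triangle[of "F p" p "G p"] by (auto simp: U_def simp flip: dS1_eq_0_iff)
      with pos show "\<exists>e>0. \<forall>G\<in>Diff1tau \<tau>. dC1 F G < e \<longrightarrow> G \<in> U" by blast
    qed (auto simp: U_def)
    have "AE f in \<nu>. f \<notin> U" using p by eventually_elim (simp add: U_def)
    then have "emeasure \<nu> U = 0"
      using AE_iff_measurable[OF open_measurable[OF U], of "\<lambda>f. f \<notin> U"] by (auto simp: U_def space_\<nu>)
    moreover have "f \<in> U" using f nf by (simp add: U_def supp_def)
    ultimately show False using f U unfolding supp_def by auto
  qed
  have "circle_lift g \<and> circ_eq (g p) p" if "g \<in> semigrp (supp \<tau> \<nu>)" for g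
    using that
  proof induction
    case (gen F)
    then show ?case using fix_supp by (auto simp: supp_def Diff1tau_circle_lift)
  next
    case (comp F G)
    then have "circ_eq (G (F p)) (G p)" by (blast intro: circle_lift_circ_eq)
    moreover have "circle_lift (G \<circ> F)" using comp by (intro circle_lift_comp) auto
    ultimately show ?case using comp.IH(2) circ_eq_trans unfolding comp_apply by blast
  qed
  with assms show False unfolding fixes_point_def by blast
qed

lemma circle_cocycle_of_Diff:
  assumes "integrable \<nu> (\<lambda>f. ln (supder f))" and "integrable \<nu> (\<lambda>f. ln (infder f))"
    and "\<not> fixes_point (semigrp (supp \<tau> \<nu>))"
    and "\<pi> \<in> borel_measurable (PiM UNIV (\<lambda>_. \<nu>))" and "\<theta> \<in> borel_measurable (PiM UNIV (\<lambda>_. \<nu>))"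
    and "\<And>x. AE \<omega> in PiM UNIV (\<lambda>_. \<nu>). (\<lambda>n. dS1 (bwd \<omega> n x) (\<pi> \<omega>)) \<longlonglongrightarrow> 0"
    and "\<And>x. AE \<omega> in PiM UNIV (\<lambda>_. \<nu>). (\<lambda>n. dS1 (invbwd \<omega> n x) (\<theta> \<omega>)) \<longlonglongrightarrow> 0"
  shows "circle_cocycle \<nu> (\<lambda>f. f) (\<lambda>f. \<bar>ln (supder f)\<bar> + \<bar>ln (infder f)\<bar>) \<pi> \<theta>"
proof -
  interpret prob_space \<nu> using \<nu> by (simp add: borel_prob_Diff_def)
  show ?thesis
  proof unfold_locales
    show "circle_lift f" if "f \<in> space \<nu>" for f using that by (rule space_\<nu>_lift)
    show "(\<lambda>p. fst p (snd p)) \<in> borel_measurable (\<nu> \<Otimes>\<^sub>M borel)"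
      by (rule measurable_pair_of_continuous[OF measurable_eval circle_lift_continuous[OF space_\<nu>_lift]])
    show "(\<lambda>p. inv (fst p) (snd p)) \<in> borel_measurable (\<nu> \<Otimes>\<^sub>M borel)"
      by (rule measurable_pair_of_continuous[OF measurable_inv_at circle_lift_continuous[OF circle_lift_inv[OF space_\<nu>_lift]]])
    have "(\<lambda>p. deriv (fst p) (snd p)) \<in> borel_measurable (\<nu> \<Otimes>\<^sub>M borel)"
      by (rule measurable_pair_of_continuous[OF measurable_deriv_at circle_lift_deriv_continuous[OF space_\<nu>_lift]])
    then show "(\<lambda>p. ln \<bar>deriv (fst p) (snd p)\<bar>) \<in> borel_measurable (\<nu> \<Otimes>\<^sub>M borel)" by measurable
    show "integrable \<nu> (\<lambda>f. \<bar>ln (supder f)\<bar> + \<bar>ln (infder f)\<bar>)" using assms(1,2) by simp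
    show "\<bar>ln \<bar>deriv f x\<bar>\<bar> \<le> \<bar>ln (supder f)\<bar> + \<bar>ln (infder f)\<bar>" if "f \<in> space \<nu>" for f x
    proof -
      note f = space_\<nu>_lift[OF that]
      have "ln (infder f) \<le> ln \<bar>deriv f x\<bar>" "ln \<bar>deriv f x\<bar> \<le> ln (supder f)"
        using infder_pos[OF f] infder_le_abs_deriv[OF f, of x] abs_deriv_le_supder[OF f, of x] circle_lift_deriv_nz[OF f, of x]
        by (auto intro!: ln_mono)
      then show ?thesis by linarith
    qed
    show "\<not> (\<exists>p. AE f in \<nu>. circ_eq (f p) p)" by (rule no_common_fixed_point[OF assms(3)])
  qed (rule assms)+
qed

end

theorem theorem1p3:
  fixes \<tau> :: real and \<nu> :: "(real \<Rightarrow> real) measure"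
    and \<pi> \<theta> :: "(nat \<Rightarrow> real \<Rightarrow> real) \<Rightarrow> real"
  assumes "\<tau> > 0"
    and "borel_prob_Diff \<tau> \<nu>"
    and "integrable \<nu> (\<lambda>f. ln (supder f))"
    and "integrable \<nu> (\<lambda>f. ln (infder f))"
    and "proximal (semigrp (supp \<tau> \<nu>))"
    and "\<not> fixes_point (semigrp (supp \<tau> \<nu>))"
    and "\<pi> \<in> borel_measurable (prodM \<nu>)" and "\<theta> \<in> borel_measurable (prodM \<nu>)"
    and "\<And>\<omega>. 0 \<le> \<pi> \<omega> \<and> \<pi> \<omega> < 1" and "\<And>\<omega>. 0 \<le> \<theta> \<omega> \<and> \<theta> \<omega> < 1"
    and "\<And>x. AE \<omega> in prodM \<nu>. (\<lambda>n. dS1 (bwd \<omega> n x) (\<pi> \<omega>)) \<longlonglongrightarrow> 0"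
    and "\<And>x. AE \<omega> in prodM \<nu>. (\<lambda>n. dS1 (invbwd \<omega> n x) (\<theta> \<omega>)) \<longlonglongrightarrow> 0"
  shows "AE \<omega> in prodM \<nu>. \<forall>x.
      ((\<lambda>n. ln \<bar>deriv (invfwd \<omega> n) x\<bar> / real n) \<longlonglongrightarrow>
          (if circ_eq x (\<pi> \<omega>) then - LyapMin \<nu> else - LyapMax \<nu>))
    \<and> ((\<lambda>n. ln \<bar>deriv (fwd \<omega> n) x\<bar> / real n) \<longlonglongrightarrow>
          (if circ_eq x (\<theta> \<omega>) then LyapMax \<nu> else LyapMin \<nu>))"
proof -
  let ?P = "PiM UNIV (\<lambda>_::nat. \<nu>)"
  have "prob_space \<nu>" using assms(2) by (simp add: borel_prob_Diff_def)
  then interpret P: prob_space ?P by (intro prob_space_PiM)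
  note cocycle = circle_cocycle_of_Diff[OF assms(2,3,4,6,7,8,11,12)[unfolded prodM_def]]
  obtain L l where
    lim: "AE \<omega> in ?P. (\<forall>x. (\<lambda>n. ln \<bar>deriv (fwd \<omega> n) x\<bar> / real n) \<longlonglongrightarrow> (if circ_eq x (\<theta> \<omega>) then L else l))
      \<and> (\<lambda>n. ln (supder (fwd \<omega> n)) / real n) \<longlonglongrightarrow> L \<and> (\<lambda>n. ln (infder (fwd \<omega> n)) / real n) \<longlonglongrightarrow> l"
    and inv_lim: "AE \<omega> in ?P. \<forall>x. (\<lambda>n. ln \<bar>deriv (invfwd \<omega> n) x\<bar> / real n) \<longlonglongrightarrow> (if circ_eq x (\<pi> \<omega>) then - l else - L)"
    using circle_cocycle.exponents[OF cocycle] circle_cocycle.exponents_inverse[OF cocycle] by (rule that)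
  \<comment> \<open>The description operator needs uniqueness: two almost sure limits agree at some
    common \<open>\<omega>\<close>, because the product measure is a probability.\<close>
  have max: "LyapMax \<nu> = L"
    unfolding LyapMax_def prodM_def
  proof (rule the_equality)
    show lim': "AE \<omega> in ?P. (\<lambda>n. ln (supder (fwd \<omega> n)) / real n) \<longlonglongrightarrow> L"
      using lim by eventually_elim (elim conjE)
    fix L' assume "AE \<omega> in ?P. (\<lambda>n. ln (supder (fwd \<omega> n)) / real n) \<longlonglongrightarrow> L'"
    then have "AE \<omega> in ?P. L' = L" using lim' by eventually_elim (rule LIMSEQ_unique)
    from P.AE_imp_ex[OF this] show "L' = L" by simp
  qed
  have min: "LyapMin \<nu> = l"
    unfolding LyapMin_def prodM_def
  proof (rule the_equality)
    show lim': "AE \<omega> in ?P. (\<lambda>n. ln (infder (fwd \<omega> n)) / real n) \<longlonglongrightarrow> l"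
      using lim by eventually_elim (elim conjE)
    fix l' assume "AE \<omega> in ?P. (\<lambda>n. ln (infder (fwd \<omega> n)) / real n) \<longlonglongrightarrow> l'"
    then have "AE \<omega> in ?P. l' = l" using lim' by eventually_elim (rule LIMSEQ_unique)
    from P.AE_imp_ex[OF this] show "l' = l" by simp
  qed
  show ?thesis
    unfolding max min prodM_def using lim inv_lim
    by eventually_elim (intro allI conjI, (elim conjE allE, assumption)+)
qed

end
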